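(* Let $X$ be an infinite Tychonoff space. The following are equivalent: (1) $\mathcal P_{\mathrm{fin}}(X)$ is Gerlits-Nagy. (2) $\mathcal P_{\mathrm{fin}}(X)\models\mathsf S_1(\Omega,\Omega^{\mathrm{gp}})$. (3) $X\models\mathsf S_1(\Omega,\Omega^{\mathrm{gp}})$. (4) Every finite power of $X$ is Gerlits-Nagy. (5) One does not have a winning strategy in $\mathsf G_1(\Omega_X,\Omega_X^{\mathrm{gp}})$. (6) $C_p(X)\models\mathsf S_1(\Omega_{C_p(X),\mathbf 0},\Omega_{C_p(X),\mathbf 0}^{\mathrm{gp}})$. (7) $C_p(X)$ is Reznichenko and has countable strong fan-tightness.
   Context: Tychonoff spaces are Hausdorff. For a set $Y$, $[Y]^{<\omega}$ is the set of non-empty finite subsets of $Y$ and $[Y]^\omega$ is the set of countably infinite subsets of $Y$. For a space $Z$, $\mathscr T_Z$ is the set of open $U\subseteq Z$ with $U\neq\emptyset$ and $U\neq Z$; $\mathcal O_Z$ is the set of all $\mathscr U\subseteq\mathscr T_Z$ with $\bigcup\mathscr U=Z$; $\Omega_Z$ (the $\omega$-covers) is the set of all $\mathscr U\in\mathcal O_Z$ such that every $F\in[Z]^{<\omega}$ is contained in some $U\in\mathscr U$. $\mathcal P_{\mathrm{fin}}(X)$ is the set $[X]^{<\omega}$ with the subspace topology inherited from the space of non-empty compact subsets of $X$ with the Vietoris topology (generated by the sets $\{K:K\subseteq U\}$ and $\{K:K\cap U\neq\emptyset\}$ for $U\subseteq X$ open). $\mathsf S_1(\mathcal A,\mathcal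 B)$: for every sequence $\langle\mathscr U_n:n\in\omega\rangle$ in $\mathcal A$ there are $A_n\in\mathscr U_n$ with $\{A_n:n\in\omega\}\in\mathcal B$. $Z\models\mathsf S_1(\Omega,\Omega^{\mathrm{gp}})$ means $\mathsf S_1(\Omega_Z,\Omega_Z^{\mathrm{gp}})$ holds; $Z\models\mathsf S_1(\mathcal A,\mathcal B)$ for specific collections means the principle holds for these collections. $Z$ is Hurewicz if for every sequence $\langle\mathscr U_n:n\in\omega\rangle$ in $\mathcal O_Z$ there are $\mathscr F_n\in[\mathscr U_n]^{<\omega}$ such that for every $z\in Z$ there is $m$ with $z\in\bigcup\mathscr F_n$ for all $n\geq m$. $Z$ is Rothberger if $\mathsf S_1(\mathcal O_Z,\mathcal O_Z)$ holds. $Z$ is Gerlits-Nagy if it is both Hurewicz and Rothberger. $C_p(X)$ is the set of continuous real-valued functions on $X$ with the topology of pointwise convergence; $\mathbf 0$ is the constant zero function. For a class $\mathfrak C$, $\mathscr C\in\mathfrak C$ is groupable if there is $\phi:\mathscr C\to\omega$ with every $\phi^{-1}(n)$ finite and with $\bigcup\{\phi^{-1}(n):n\in J\}\in\mathfrak C$ for every infinite $J\subseteq\omega$; $\mathfrak C^{\mathrm{gp}}$ is the set of groupable members of $\mathfrak C$. In the game $\mathsf G_1(\mathcal A,\mathcal B)$, in inning $n\in\omega$ One plays $A_n\in\mathcal A$ and Two responds with $x_n\in A_n$; Two wins if $\{x_n:n\in\omega\}\in\mathcal B$, otherwise One wins. A strategy for One is a function $\sigma$ from finite sequences of elements of $\bigcup\mathcal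 A$ to $\mathcal A$; it is winning if whenever $x_n\in\sigma(\langle x_k:k<n\rangle)$ for all $n$, $\{x_n:n\in\omega\}\notin\mathcal B$. For a space $Z$ and $z\in Z$, $\Omega_{Z,z}=\{A\subseteq Z: z\in\mathrm{cl}(A)\setminus A\}$. $Z$ has countable strong fan-tightness if $\mathsf S_1(\Omega_{Z,z},\Omega_{Z,z})$ holds for every $z\in Z$. $Z$ is Reznichenko if $\Omega_{Z,z}\cap[Z]^\omega=\Omega_{Z,z}^{\mathrm{gp}}$ for every $z\in Z$. *)

theory Defs
  imports "HOL-Analysis.Analysis"
begin

definition fin_subsets :: "'a set \<Rightarrow> 'a set set" where
  "fin_subsets Y = {F. F \<subseteq> Y \<and> finite F \<and> F \<noteq> {}}"

definition ctbl_inf_subsets :: "'a set \<Rightarrow> 'a set set" where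
  "ctbl_inf_subsets Y = {A. A \<subseteq> Y \<and> countable A \<and> infinite A}"

definition proper_opens :: "'a topology \<Rightarrow> 'a set set" where
  "proper_opens Z = {U. openin Z U \<and> U \<noteq> {} \<and> U \<noteq> topspace Z}"

definition open_covers :: "'a topology \<Rightarrow> 'a set set set" where
  "open_covers Z = {\<U>. \<U> \<subseteq> proper_opens Z \<and> \<Union>\<U> = topspace Z}"

definition omega_covers :: "'a topology \<Rightarrow> 'a set set set" where
  "omega_covers Z =
     {\<U> \<in> open_covers Z. \<forall>F \<in> fin_subsets (topspace Z). \<exists>U \<in> \<U>. F \<subseteq> U}"

definition clusters_at :: "'a topology \<Rightarrow> 'a \<Rightarrow> 'a set set" where
  "clusters_at Z z = {A. A \<subseteq> topspace Z \<and> z \<in> (Z closure_of A) - A}"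

definition groupable :: "'b set set \<Rightarrow> 'b set set" where
  "groupable \<CC> =
     {C \<in> \<CC>. \<exists>\<phi> :: 'b \<Rightarrow> nat.
        (\<forall>n. finite {c \<in> C. \<phi> c = n}) \<and>
        (\<forall>J. infinite J \<longrightarrow> (\<Union>n\<in>J. {c \<in> C. \<phi> c = n}) \<in> \<CC>)}"

definition S1 :: "'b set set \<Rightarrow> 'b set set \<Rightarrow> bool" where
  "S1 \<A> \<B> \<longleftrightarrow>
     (\<forall>U :: nat \<Rightarrow> 'b set. (\<forall>n. U n \<in> \<A>) \<longrightarrow>
        (\<exists>x. (\<forall>n. x n \<in> U n) \<and> range x \<in> \<B>))"

text \<open>Strategies for One are total functions on lists; only their values on finite sequences
  of elements of \<open>\<Union>\<A>\<close> are constrained, and only those matter in a play.\<close>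

definition strategy_One :: "'b set set \<Rightarrow> ('b list \<Rightarrow> 'b set) \<Rightarrow> bool" where
  "strategy_One \<A> \<sigma> \<longleftrightarrow> (\<forall>s \<in> lists (\<Union>\<A>). \<sigma> s \<in> \<A>)"

definition winning_strategy_One ::
    "'b set set \<Rightarrow> 'b set set \<Rightarrow> ('b list \<Rightarrow> 'b set) \<Rightarrow> bool" where
  "winning_strategy_One \<A> \<B> \<sigma> \<longleftrightarrow>
     strategy_One \<A> \<sigma> \<and>
     (\<forall>x :: nat \<Rightarrow> 'b. (\<forall>n. x n \<in> \<sigma> (map x [0..<n])) \<longrightarrow> range x \<notin> \<B>)"

definition Hurewicz_space :: "'a topology \<Rightarrow> bool" where
  "Hurewicz_space Z \<longleftrightarrow>
     (\<forall>\<U> :: nat \<Rightarrow> 'a set set. (\<forall>n. \<U> n \<in> open_covers Z) \<longrightarrow>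
        (\<exists>\<F>. (\<forall>n. \<F> n \<in> fin_subsets (\<U> n)) \<and>
             (\<forall>z \<in> topspace Z. \<exists>m. \<forall>n\<ge>m. z \<in> \<Union>(\<F> n))))"

definition Rothberger_space :: "'a topology \<Rightarrow> bool" where
  "Rothberger_space Z \<longleftrightarrow> S1 (open_covers Z) (open_covers Z)"

definition Gerlits_Nagy_space :: "'a topology \<Rightarrow> bool" where
  "Gerlits_Nagy_space Z \<longleftrightarrow> Hurewicz_space Z \<and> Rothberger_space Z"

definition countable_strong_fan_tightness :: "'a topology \<Rightarrow> bool" where
  "countable_strong_fan_tightness Z \<longleftrightarrow>
     (\<forall>z \<in> topspace Z. S1 (clusters_at Z z) (clusters_at Z z))"

definition Reznichenko_space :: "'a topology \<Rightarrow> bool" where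
  "Reznichenko_space Z \<longleftrightarrow>
     (\<forall>z \<in> topspace Z.
        clusters_at Z z \<inter> ctbl_inf_subsets (topspace Z) = groupable (clusters_at Z z))"

definition nonempty_compacts :: "'a topology \<Rightarrow> 'a set set" where
  "nonempty_compacts X = {K. compactin X K \<and> K \<noteq> {}}"

definition Vietoris :: "'a topology \<Rightarrow> 'a set topology" where
  "Vietoris X = topology_generated_by
     ({{K \<in> nonempty_compacts X. K \<subseteq> U} |U. openin X U} \<union>
      {{K \<in> nonempty_compacts X. K \<inter> U \<noteq> {}} |U. openin X U})"

definition Pfin :: "'a topology \<Rightarrow> 'a set topology" where
  "Pfin X = subtopology (Vietoris X) (fin_subsets (topspace X))"

text \<open>Real-valued functions on \<open>X\<close> are represented by extensional functions, i.e. points of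
  \<open>product_topology (\<lambda>_. euclideanreal) (topspace X)\<close>, which take the value \<open>undefined\<close>
  off \<open>topspace X\<close>; the zero function is restricted accordingly.\<close>

definition Cp :: "'a topology \<Rightarrow> ('a \<Rightarrow> real) topology" where
  "Cp X = subtopology (product_topology (\<lambda>_. euclideanreal) (topspace X))
            {f. continuous_map X euclideanreal f}"

definition Cp_zero :: "'a topology \<Rightarrow> 'a \<Rightarrow> real" where
  "Cp_zero X = (\<lambda>x\<in>topspace X. 0)"

definition finite_power :: "'a topology \<Rightarrow> nat \<Rightarrow> (nat \<Rightarrow> 'a) topology" where
  "finite_power X n = product_topology (\<lambda>_. X) {..<n}"

lemma topspace_Vietoris: "topspace (Vietoris X) = nonempty_compacts X"
proof -
  let ?S = "{{K \<in> nonempty_compacts X. K \<subseteq> U} |U. openin X U}"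
  let ?T = "{{K \<in> nonempty_compacts X. K \<inter> U \<noteq> {}} |U. openin X U}"
  have "K \<subseteq> topspace X" if "K \<in> nonempty_compacts X" for K
    using that by (simp add: nonempty_compacts_def compactin_subset_topspace)
  then have "nonempty_compacts X = {K \<in> nonempty_compacts X. K \<subseteq> topspace X}"
    by (simp cong: conj_cong)
  then have "nonempty_compacts X \<in> ?S"
    by (intro CollectI exI[of _ "topspace X"] conjI openin_topspace)
  then have "nonempty_compacts X \<subseteq> \<Union>(?S \<union> ?T)"
    by (intro Union_upper UnI1)
  moreover have "\<Union>(?S \<union> ?T) \<subseteq> nonempty_compacts X"
    by (rule Union_least) (elim UnE CollectE exE conjE, simp_all)
  ultimately show ?thesis
    unfolding Vietoris_def topology_generated_by_topspace by (intro equalityI)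
qed

lemma topspace_Pfin: "topspace (Pfin X) = fin_subsets (topspace X)"
proof -
  have "fin_subsets (topspace X) \<subseteq> nonempty_compacts X"
    by (simp add: fin_subsets_def nonempty_compacts_def subset_iff finite_imp_compactin)
  then show ?thesis
    unfolding Pfin_def topspace_subtopology topspace_Vietoris by (rule Int_absorb1)
qed

lemma topspace_Cp:
  "topspace (Cp X) = {f \<in> extensional (topspace X). continuous_map X euclideanreal f}"
  unfolding Cp_def topspace_subtopology topspace_product_topology PiE_def by (simp add: Int_def)

lemma Cp_zero_in_Cp: "Cp_zero X \<in> topspace (Cp X)"
proof -
  have "continuous_map X euclideanreal (\<lambda>x. 0)"
    by simp
  then have "continuous_map X euclideanreal (Cp_zero X)"
    by (rule continuous_map_eq) (simp add: Cp_zero_def)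
  then show ?thesis
    unfolding topspace_Cp by (simp add: Cp_zero_def)
qed

end

theory Submission
  imports Defs
begin

text \<open>Every object of the theorem is a covering problem over a Gerlits-Nagy space. Attach to each
  possible move \<open>c\<close> an open set \<open>V c\<close> of a space \<open>Z\<close>; a set of moves is good when its open sets cover \<open>Z\<close>
  (\<open>covering\<close>). For \<open>\<omega>\<close>-covers of \<open>X\<close> take \<open>Z = Pfin X\<close> and \<open>V U = {F. F \<subseteq> U}\<close>. For \<open>\<omega>\<close>-covers of
  \<open>Pfin X\<close> and for sets of functions clustering at zero take for \<open>Z\<close> a countable disjoint sum of finite
  powers of \<open>X\<close>: a point of it is a tuple together with an index from a countable set, namely
  a finite family of finite index sets in the first case and a bound \<open>1 / (k + 1)\<close> in the second.

  Two facts about such problems carry the proof. By \<open>Hurewicz_countable_groupable\<close>, if \<open>Z\<close> is Hurewicz then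
  every countable good set is groupable: after removal of its first \<open>m\<close> moves it is still good,
  because every point \<open>z\<close> can be traded for one that these moves miss and all other moves catch only if
  they catch \<open>z\<close> (\<open>separated_pieces\<close>), and the
  Hurewicz property turns these tails into finite blocks which catch every point from some block on.
  By \<open>One_no_winning_strategy\<close>, One has no winning strategy in the game on a Gerlits-Nagy space. The
  Hurewicz property bounds in advance the moves with which Two has to reckon, so that at each inning only
  finitely many positions matter; the Rothberger property then guesses an answer at all of these positions
  at once, and following the guesses produces a countable good set, which is groupable by the first fact.

  The countable sum of the finite powers of \<open>X\<close> inherits the Gerlits-Nagy property from its summands
  and has \<open>Pfin X\<close> as a continuous image. Hence the condition on finite powers implies the conditions on
  \<open>Pfin X\<close> and the groupable selection principle at the zero function, and \<open>Pfin X\<close> being Gerlits-Nagy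
  implies the condition on the game. The remaining implications lead back. Strategies of One that ignore
  the answers turn the game into the groupable selection principle for \<open>\<omega>\<close>-covers of \<open>X\<close>. The map \<open>U \<mapsto> {F. F \<subseteq> U}\<close>
  carries this principle from \<open>Pfin X\<close> to \<open>X\<close>. From clustering functions to \<open>\<omega>\<close>-covers of \<open>X\<close> one
  passes by replacing a cover with the functions that are constantly 1 outside one of its members. And the
  principle for \<open>X\<close> makes the finite powers Gerlits-Nagy, since a finite set \<open>F\<close> whose power lies in
  an open set \<open>W\<close> of the power space has a neighbourhood \<open>U\<close> whose power still lies in \<open>W\<close>, so that
  covers of the power yield \<open>\<omega>\<close>-covers of \<open>X\<close>. Finally, the groupable selection principle at zero is the
  plain one together with groupability of all countable sets clustering there, and translations make all
  points of the function space alike; this accounts for the Reznichenko property and fan tightness.\<close>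

section \<open>Selections in Hurewicz and Rothberger spaces\<close>

lemma open_covers_iff:
  "\<U> \<in> open_covers Z \<longleftrightarrow> \<U> \<subseteq> proper_opens Z \<and> topspace Z \<subseteq> \<Union>\<U>"
proof -
  have "\<Union>\<U> \<subseteq> topspace Z" if "\<U> \<subseteq> proper_opens Z"
    by (rule Sup_least) (use that openin_subset in \<open>auto simp: proper_opens_def\<close>)
  then show ?thesis unfolding open_covers_def by auto
qed

lemma open_cover_nonempty:
  assumes "\<U> \<in> open_covers Z" "topspace Z \<noteq> {}"
  shows "\<U> \<noteq> {}"
proof
  assume "\<U> = {}"
  then have "topspace Z = {}" using assms(1) unfolding open_covers_def by simp
  with assms(2) show False by contradiction
qed

text \<open>Members of \<open>open_covers\<close> are neither empty nor the whole space, whereas the families that arise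
  below may contain such sets. Empty sets are dropped here; a family containing the whole space makes the
  selection trivial and is treated separately in the two selection lemmas.\<close>

lemma open_covers_nonempty_pieces:
  assumes "\<And>c. c \<in> C \<Longrightarrow> openin Z (V c)" and "topspace Z \<subseteq> (\<Union>c\<in>C. V c)"
    and "\<And>c. c \<in> C \<Longrightarrow> V c \<noteq> topspace Z"
  shows "V ` C - {{}} \<in> open_covers Z"
  using assms openin_subset unfolding open_covers_def proper_opens_def by fastforce

text \<open>The Hurewicz property for arbitrary indexed open families that cover. At a stage where some
  index yields the whole space, that index alone is chosen; the cover of such a stage is replaced by that
  of a fixed stage \<open>n0\<close> without this feature, only to have a sequence of admissible covers.\<close>

lemma Hurewicz_select:
  fixes C :: "nat \<Rightarrow> 'c set" and V :: "nat \<Rightarrow> 'c \<Rightarrow> 'z set"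
  assumes H: "Hurewicz_space Z"
    and opn: "\<And>n c. c \<in> C n \<Longrightarrow> openin Z (V n c)"
    and cov: "\<And>n. topspace Z \<subseteq> (\<Union>c\<in>C n. V n c)"
  obtains F where "\<And>n. finite (F n)" "\<And>n. F n \<subseteq> C n"
    and "\<And>z. z \<in> topspace Z \<Longrightarrow> \<exists>m. \<forall>n\<ge>m. \<exists>c\<in>F n. z \<in> V n c"
proof (cases "\<forall>n. \<exists>c\<in>C n. V n c = topspace Z")
  case True
  then obtain c where c: "\<And>n. c n \<in> C n" "\<And>n. V n (c n) = topspace Z" by metis
  show ?thesis by (rule that[of "\<lambda>n. {c n}"]) (use c in auto)
next
  case False
  then obtain n0 where n0: "\<And>c. c \<in> C n0 \<Longrightarrow> V n0 c \<noteq> topspace Z" by blast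
  define good where "good n \<longleftrightarrow> (\<exists>c\<in>C n. V n c = topspace Z)" for n
  define r where "r n = (if good n then n0 else n)" for n
  define \<U> where "\<U> n = V (r n) ` C (r n) - {{}}" for n
  have r: "V (r n) c \<noteq> topspace Z" if "c \<in> C (r n)" for n c
    using that n0 unfolding r_def good_def by (cases "\<exists>c\<in>C n. V n c = topspace Z") auto
  have "\<U> n \<in> open_covers Z" for n
    unfolding \<U>_def by (rule open_covers_nonempty_pieces) (use opn cov r in auto)
  then obtain \<F> where \<F>: "\<And>n. \<F> n \<in> fin_subsets (\<U> n)"
      "\<And>z. z \<in> topspace Z \<Longrightarrow> \<exists>m. \<forall>n\<ge>m. z \<in> \<Union>(\<F> n)"
    using H[unfolded Hurewicz_space_def, rule_format, of \<U>] by blast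
  define pick where "pick n U = (SOME c. c \<in> C n \<and> V n c = U)" for n U
  have pick: "pick n U \<in> C n" "V n (pick n U) = U" if "U \<in> V n ` C n" for n U
    using that someI_ex[of "\<lambda>c. c \<in> C n \<and> V n c = U"] unfolding pick_def by blast+
  define F where "F n = (if good n then {pick n (topspace Z)} else pick n ` \<F> n)" for n
  have sub: "\<F> n \<subseteq> V n ` C n" if "\<not> good n" for n
    using \<F>(1)[of n] that unfolding fin_subsets_def \<U>_def r_def by auto
  have good: "topspace Z \<in> V n ` C n" if "good n" for n
    using that unfolding good_def by blast
  show ?thesis
  proof (rule that[of F])
    show "finite (F n)" for n using \<F>(1)[of n] unfolding F_def fin_subsets_def by auto
    show "F n \<subseteq> C n" for n using pick(1)[of _ n] sub[of n] good[of n] unfolding F_def by (auto simp: subset_iff)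
    fix z assume z: "z \<in> topspace Z"
    then obtain m where m: "\<And>n. n \<ge> m \<Longrightarrow> z \<in> \<Union>(\<F> n)" using \<F>(2) by blast
    have "\<exists>c\<in>F n. z \<in> V n c" if n: "n \<ge> m" for n
    proof (cases "good n")
      case True
      then show ?thesis using pick(2)[OF good] z unfolding F_def by simp
    next
      case False
      obtain U where U: "U \<in> \<F> n" "z \<in> U" using m[OF n] by blast
      then have "V n (pick n U) = U" using pick(2) sub[OF False] by blast
      with U False show ?thesis unfolding F_def by auto
    qed
    then show "\<exists>m. \<forall>n\<ge>m. \<exists>c\<in>F n. z \<in> V n c" by blast
  qed
qed

lemma Hurewicz_select_nat:
  fixes V :: "nat \<Rightarrow> nat \<Rightarrow> 'z set"
  assumes H: "Hurewicz_space Z"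
    and opn: "\<And>n i. openin Z (V n i)"
    and cov: "\<And>n. topspace Z \<subseteq> (\<Union>i. V n i)"
  obtains g where "\<And>z. z \<in> topspace Z \<Longrightarrow> \<exists>m. \<forall>n\<ge>m. \<exists>i<g n. z \<in> V n i"
proof -
  obtain F :: "nat \<Rightarrow> nat set" where F: "\<And>n. finite (F n)"
      "\<And>z. z \<in> topspace Z \<Longrightarrow> \<exists>m. \<forall>n\<ge>m. \<exists>i\<in>F n. z \<in> V n i"
    using Hurewicz_select[OF H, where C = "\<lambda>_. UNIV" and V = V] opn cov by metis
  have "\<forall>n. \<exists>k. \<forall>i\<in>F n. i < k"
    using F(1) finite_nat_set_iff_bounded by blast
  then obtain g where g: "\<And>n i. i \<in> F n \<Longrightarrow> i < g n" by metis
  show ?thesis by (rule that[of g]) (use F(2) g in meson)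
qed

lemma Rothberger_select:
  fixes C :: "nat \<Rightarrow> 'c set" and V :: "nat \<Rightarrow> 'c \<Rightarrow> 'z set"
  assumes R: "Rothberger_space Z"
    and ne: "\<And>n. C n \<noteq> {}"
    and opn: "\<And>n c. c \<in> C n \<Longrightarrow> openin Z (V n c)"
    and cov: "\<And>n. topspace Z \<subseteq> (\<Union>c\<in>C n. V n c)"
  obtains c where "\<And>n. c n \<in> C n" and "\<And>z. z \<in> topspace Z \<Longrightarrow> \<exists>n. z \<in> V n (c n)"
proof (cases "\<exists>n0. \<exists>c\<in>C n0. V n0 c = topspace Z")
  case True
  then obtain n0 c0 where c0: "c0 \<in> C n0" "V n0 c0 = topspace Z" by blast
  define c where "c n = (SOME c. c \<in> C n)" for n
  have c: "c n \<in> C n" for n unfolding c_def using ne[of n] by (simp add: some_in_eq)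
  show ?thesis by (rule that[of "c(n0 := c0)"]) (use c c0 in auto)
next
  case False
  then have "V n ` C n - {{}} \<in> open_covers Z" for n
    by (intro open_covers_nonempty_pieces) (use opn cov in auto)
  then obtain U where "\<forall>n. U n \<in> V n ` C n - {{}}" and U: "range U \<in> open_covers Z"
    using R[unfolded Rothberger_space_def S1_def, rule_format, of "\<lambda>n. V n ` C n - {{}}"] by blast
  then have "\<forall>n. \<exists>c\<in>C n. V n c = U n" by blast
  then obtain c where c: "\<And>n. c n \<in> C n" "\<And>n. V n (c n) = U n" by metis
  show ?thesis by (rule that[of c]) (use c U in \<open>auto simp: open_covers_def\<close>)
qed

text \<open>Greedy choice: when the \<open>m\<close>-th representative is picked, at most \<open>m\<close> of the \<open>Suc m\<close> candidates
  are taken.\<close>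

lemma distinct_representatives:
  fixes N :: "nat \<Rightarrow> nat set"
  assumes "\<And>m. finite (N m)" "\<And>m. card (N m) = Suc m"
  obtains k :: "nat \<Rightarrow> nat" where "inj k" "\<And>m. k m \<in> N m"
proof -
  have "\<exists>k. \<forall>m. k m \<in> N m - k ` {..<m}"
  proof (rule dependent_wellorder_choice)
    fix m and k :: "nat \<Rightarrow> nat"
    have "card (k ` {..<m}) < card (N m)"
      using assms(2) card_image_le[of "{..<m}" k] by (simp add: le_imp_less_Suc)
    then have "\<not> N m \<subseteq> k ` {..<m}" by (metis card_mono finite_imageI finite_lessThan leD)
    then show "\<exists>r. r \<in> N m - k ` {..<m}" by blast
  next
    fix r m and f g :: "nat \<Rightarrow> nat" assume "\<And>y. y < m \<Longrightarrow> f y = g y"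
    then have "f ` {..<m} = g ` {..<m}" by (intro image_cong) auto
    then show "(r \<in> N m - f ` {..<m}) = (r \<in> N m - g ` {..<m})" by simp
  qed
  then obtain k where k: "\<And>m. k m \<in> N m - k ` {..<m}" by blast
  have "inj k"
  proof (rule linorder_injI)
    show "k x \<noteq> k y" if "x < y" for x y
      using k[of y] that by (metis DiffD2 imageI lessThan_iff)
  qed
  with k that show ?thesis by blast
qed

text \<open>The families need not cover; each point only has to lie in infinitely many of the unions. The
  intersections of \<open>Suc m\<close> sets taken from different families do form a cover for each \<open>m\<close>. Select one
  such intersection for each \<open>m\<close>, and then keep from it a single factor whose family has not been used
  before: it contains the whole intersection, so the chosen factors still cover.\<close>

lemma Rothberger_select_frequently:
  fixes \<V> :: "nat \<Rightarrow> 'z set set"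
  assumes R: "Rothberger_space Z"
    and ne: "\<And>n. \<V> n \<noteq> {}"
    and opn: "\<And>n U. U \<in> \<V> n \<Longrightarrow> openin Z U"
    and freq: "\<And>z. z \<in> topspace Z \<Longrightarrow> infinite {n. z \<in> \<Union>(\<V> n)}"
  obtains U where "\<And>n. U n \<in> \<V> n" and "\<And>z. z \<in> topspace Z \<Longrightarrow> \<exists>n. z \<in> U n"
proof -
  define d where "d n = (SOME U. U \<in> \<V> n)" for n
  have d: "d n \<in> \<V> n" for n unfolding d_def using ne[of n] by (simp add: some_in_eq)
  define C where "C m = {(N, f). finite (N :: nat set) \<and> card N = Suc m \<and> (\<forall>n\<in>N. f n \<in> \<V> n)}" for m
  have opnV: "openin Z (case p of (N, f) \<Rightarrow> \<Inter> (f ` N))" if "p \<in> C m" for m p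
  proof -
    obtain N f where p: "p = (N, f)" by (cases p)
    have "finite N" "N \<noteq> {}" "\<forall>n\<in>N. f n \<in> \<V> n" using that unfolding C_def p by auto
    then have "openin Z (\<Inter> (f ` N))" using opn by (intro openin_Inter) auto
    then show ?thesis unfolding p by simp
  qed
  have covV: "topspace Z \<subseteq> (\<Union>p\<in>C m. case p of (N, f) \<Rightarrow> \<Inter> (f ` N))" for m
  proof
    fix z assume "z \<in> topspace Z"
    then obtain N where N: "finite N" "card N = Suc m" "N \<subseteq> {n. z \<in> \<Union>(\<V> n)}"
      using freq infinite_arbitrarily_large by blast
    then have "\<forall>n\<in>N. \<exists>U\<in>\<V> n. z \<in> U" by blast
    then obtain f where "\<forall>n\<in>N. f n \<in> \<V> n \<and> z \<in> f n" by metis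
    with N have "(N, f) \<in> C m" "z \<in> \<Inter> (f ` N)" unfolding C_def by auto
    then show "z \<in> (\<Union>p\<in>C m. case p of (N, f) \<Rightarrow> \<Inter> (f ` N))" by force
  qed
  have neC: "C m \<noteq> {}" for m
  proof -
    have "({..<Suc m}, d) \<in> C m" unfolding C_def using d by simp
    then show ?thesis by blast
  qed
  obtain p where p: "\<And>m. p m \<in> C m"
      "\<And>z. z \<in> topspace Z \<Longrightarrow> \<exists>m. z \<in> (case p m of (N, f) \<Rightarrow> \<Inter> (f ` N))"
    by (rule Rothberger_select[OF R, of C "\<lambda>_ p. case p of (N, f) \<Rightarrow> \<Inter> (f ` N)"])
      (use neC opnV covV in auto)
  define N where "N m = fst (p m)" for m
  define f where "f m = snd (p m)" for m
  have N: "finite (N m)" "card (N m) = Suc m" "\<And>n. n \<in> N m \<Longrightarrow> f m n \<in> \<V> n" for m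
    using p(1)[of m] unfolding C_def N_def f_def by (auto simp: case_prod_beta)
  obtain k where k: "inj k" "\<And>m. k m \<in> N m"
    using distinct_representatives[of N] N by metis
  define U where "U n = (if n \<in> range k then f (inv k n) n else d n)" for n
  show ?thesis
  proof (rule that[of U])
    show "U n \<in> \<V> n" for n
      using N(3) k d unfolding U_def by (auto simp: inv_f_f)
    fix z assume "z \<in> topspace Z"
    then obtain m where "z \<in> \<Inter> (f m ` N m)"
      using p(2) unfolding N_def f_def by (auto simp: case_prod_beta)
    then have "z \<in> U (k m)" unfolding U_def using k by (auto simp: inv_f_f)
    then show "\<exists>n. z \<in> U n" by blast
  qed
qed

section \<open>Groupable coverings\<close>

definition covering :: "'z topology \<Rightarrow> 'c set \<Rightarrow> ('c \<Rightarrow> 'z set) \<Rightarrow> 'c set set" where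
  "covering Z P V = {C. C \<subseteq> P \<and> topspace Z \<subseteq> (\<Union>c\<in>C. V c)}"

lemma groupableI:
  fixes \<phi> :: "'b \<Rightarrow> nat"
  assumes "C \<in> \<CC>" and "\<And>n. finite {c \<in> C. \<phi> c = n}"
    and "\<And>J. infinite J \<Longrightarrow> (\<Union>n\<in>J. {c \<in> C. \<phi> c = n}) \<in> \<CC>"
  shows "C \<in> groupable \<CC>"
  unfolding groupable_def using assms by (intro CollectI conjI exI[of _ \<phi>]) simp_all

text \<open>Otherwise the blocks without a member satisfying \<open>Q\<close> are infinitely many, and their union would
  be a member of \<open>\<CC>\<close> without any element satisfying \<open>Q\<close>.\<close>

lemma groupable_eventually:
  assumes C: "C \<in> groupable \<CC>"
  obtains \<phi> :: "'b \<Rightarrow> nat" where "\<And>n. finite {c \<in> C. \<phi> c = n}"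
    and "\<And>Q. \<forall>D\<in>\<CC>. \<exists>c\<in>D. Q c \<Longrightarrow> \<exists>m. \<forall>n\<ge>m. \<exists>c\<in>C. \<phi> c = n \<and> Q c"
proof -
  obtain \<phi> :: "'b \<Rightarrow> nat" where fin: "\<And>n. finite {c \<in> C. \<phi> c = n}"
    and un: "\<And>J. infinite J \<Longrightarrow> (\<Union>n\<in>J. {c \<in> C. \<phi> c = n}) \<in> \<CC>"
    using C unfolding groupable_def by blast
  have "\<exists>m. \<forall>n\<ge>m. \<exists>c\<in>C. \<phi> c = n \<and> Q c" if Q: "\<forall>D\<in>\<CC>. \<exists>c\<in>D. Q c" for Q
  proof (rule ccontr)
    assume "\<not> ?thesis"
    then have "infinite {n. \<not> (\<exists>c\<in>C. \<phi> c = n \<and> Q c)}" (is "infinite ?J")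
      unfolding infinite_nat_iff_unbounded_le by auto
    from bspec[OF Q un[OF this]] show False by auto
  qed
  with fin show ?thesis by (rule that)
qed

text \<open>The blocks \<open>G k\<close> may overlap and need not exhaust \<open>C\<close>. Since every element lies in only finitely
  many of them, some subsequence of blocks is pairwise disjoint; the elements outside this subsequence are
  distributed one by one along an enumeration of \<open>C\<close>, which does no harm as groups may be enlarged.\<close>

lemma groupable_coveringI:
  fixes G :: "nat \<Rightarrow> 'c set"
  assumes C: "C \<in> covering Z P V" "countable C"
    and G: "\<And>k. finite (G k)" "\<And>k. G k \<subseteq> C"
    and pf: "\<And>c. c \<in> C \<Longrightarrow> finite {k. c \<in> G k}"
    and ev: "\<And>z. z \<in> topspace Z \<Longrightarrow> \<exists>m. \<forall>k\<ge>m. \<exists>c\<in>G k. z \<in> V c"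
  shows "C \<in> groupable (covering Z P V)"
proof -
  have "\<exists>M. \<forall>l\<ge>M. \<forall>i\<le>k. G l \<inter> G i = {}" for k
  proof -
    let ?L = "\<Union>c\<in>(\<Union>i\<le>k. G i). {l. c \<in> G l}"
    have "(\<Union>i\<le>k. G i) \<subseteq> C" using G(2) by (intro UN_least)
    then have "finite {l. c \<in> G l}" if "c \<in> (\<Union>i\<le>k. G i)" for c
      using that by (intro pf) (rule subsetD)
    moreover have "finite (\<Union>i\<le>k. G i)" using G(1) by (intro finite_UN_I finite_atMost)
    ultimately have "finite ?L" by (rule finite_UN_I[rotated])
    then obtain M where M: "\<forall>l\<in>?L. l < M"
      unfolding finite_nat_set_iff_bounded ..
    have "G l \<inter> G i = {}" if "l \<ge> M" "i \<le> k" for l i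
    proof (rule ccontr)
      assume "G l \<inter> G i \<noteq> {}"
      then obtain c where "c \<in> G l" "c \<in> G i" by auto
      then have "l \<in> ?L" using that(2) by auto
      with M have "l < M" ..
      with that(1) show False by simp
    qed
    then show ?thesis by (intro exI[of _ M] allI impI)
  qed
  \<comment> \<open>From block \<open>M k\<close> on, all blocks avoid those up to the \<open>k\<close>-th; iterating gives disjoint blocks.\<close>
  then have "\<forall>k. \<exists>M. \<forall>l\<ge>M. \<forall>i\<le>k. G l \<inter> G i = {}" ..
  from choice[OF this] obtain M where "\<forall>k. \<forall>l\<ge>M k. \<forall>i\<le>k. G l \<inter> G i = {}" ..
  then have M: "\<And>k l i. l \<ge> M k \<Longrightarrow> i \<le> k \<Longrightarrow> G l \<inter> G i = {}" by simp
  define r where "r = rec_nat 0 (\<lambda>_ k. max (M k) (Suc k))"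
  have rS: "r (Suc j) = max (M (r j)) (Suc (r j))" for j by (simp add: r_def)
  have sm: "strict_mono r" unfolding strict_mono_Suc_iff rS by (simp add: less_max_iff_disj)
  have dj: "G (r i) \<inter> G (r j) = {}" if ij: "i < j" for i j
  proof -
    obtain j' where j': "j = Suc j'" "i \<le> j'" using less_imp_Suc_add[OF ij] by auto
    have "r i \<le> r j'" using sm j'(2) by (simp add: strict_mono_less_eq)
    then show ?thesis using M[of "r j'" "r j" "r i"] rS[of j'] j' by auto
  qed
  have uniq: "i = j" if "c \<in> G (r i)" "c \<in> G (r j)" for i j c
  proof (rule ccontr)
    assume "i \<noteq> j"
    then have "G (r i) \<inter> G (r j) = {}" using dj[of i j] dj[of j i] by (auto simp: neq_iff)
    with that show False by auto
  qed
  define \<phi> where "\<phi> c = (if \<exists>j. c \<in> G (r j) then (THE j. c \<in> G (r j)) else to_nat_on C c)" for c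
  have \<phi>: "\<phi> c = j" if "c \<in> G (r j)" for c j
  proof -
    have "(THE j. c \<in> G (r j)) = j" using that by (rule the_equality) (rule uniq[OF _ that])
    with that show ?thesis unfolding \<phi>_def by (simp only: if_P exI[of _ j])
  qed
  have fin: "finite {c \<in> C. \<phi> c = n}" for n
  proof (rule finite_subset)
    show "{c \<in> C. \<phi> c = n} \<subseteq> G (r n) \<union> {c \<in> C. to_nat_on C c = n}"
    proof
      fix c assume c: "c \<in> {c \<in> C. \<phi> c = n}"
      show "c \<in> G (r n) \<union> {c \<in> C. to_nat_on C c = n}"
      proof (cases "\<exists>j. c \<in> G (r j)")
        case True
        then obtain j where j: "c \<in> G (r j)" ..
        then show ?thesis using \<phi>[OF j] c by simp
      next
        case False
        with c show ?thesis unfolding \<phi>_def by simp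
      qed
    qed
    have "inj_on (to_nat_on C) {c \<in> C. to_nat_on C c = n}"
      using inj_on_to_nat_on[OF C(2)] by (rule inj_on_subset) auto
    moreover have "finite (to_nat_on C ` {c \<in> C. to_nat_on C c = n})"
      by (rule finite_subset[of _ "{n}"]) auto
    ultimately have "finite {c \<in> C. to_nat_on C c = n}" using finite_imageD by blast
    then show "finite (G (r n) \<union> {c \<in> C. to_nat_on C c = n})" using G by auto
  qed
  have "(\<Union>n\<in>J. {c \<in> C. \<phi> c = n}) \<in> covering Z P V" if J: "infinite J" for J
  proof -
    have "topspace Z \<subseteq> (\<Union>c\<in>(\<Union>n\<in>J. {c \<in> C. \<phi> c = n}). V c)"
    proof
      fix z assume z: "z \<in> topspace Z"
      obtain m where m: "\<And>k. k \<ge> m \<Longrightarrow> \<exists>c\<in>G k. z \<in> V c" using ev z by blast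
      obtain n where n: "n \<ge> m" "n \<in> J"
        using J[unfolded infinite_nat_iff_unbounded_le, THEN spec, of m] by auto
      have "m \<le> r n" using n strict_mono_imp_increasing[OF sm, of n] by simp
      from m[OF this] obtain c where c: "c \<in> G (r n)" "z \<in> V c" ..
      have "c \<in> C" using c(1) G(2) by (rule rev_subsetD)
      then have "c \<in> (\<Union>n\<in>J. {c \<in> C. \<phi> c = n})" using \<phi>[OF c(1)] n(2) by simp
      then show "z \<in> (\<Union>c\<in>(\<Union>n\<in>J. {c \<in> C. \<phi> c = n}). V c)" using c(2) by (rule UN_I)
    qed
    moreover have "C \<subseteq> P" using C(1) unfolding covering_def by simp
    then have "(\<Union>n\<in>J. {c \<in> C. \<phi> c = n}) \<subseteq> P" by auto
    ultimately show ?thesis unfolding covering_def by simp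
  qed
  with C(1) fin show ?thesis by (rule groupableI)
qed

text \<open>Abstract form of two facts: a finite set of points can be enlarged so that it escapes a given
  proper open set, and a basic neighbourhood of zero can be shrunk so that it omits a given non-zero
  function. In both cases the new test \<open>z'\<close> is at least as demanding as \<open>z\<close>.\<close>

definition separated_pieces :: "'z topology \<Rightarrow> 'c set \<Rightarrow> ('c \<Rightarrow> 'z set) \<Rightarrow> bool" where
  "separated_pieces Z P V \<longleftrightarrow>
     (\<forall>z\<in>topspace Z. \<forall>c\<in>P. \<exists>z'\<in>topspace Z. z' \<notin> V c \<and> (\<forall>d\<in>P. z' \<in> V d \<longrightarrow> z \<in> V d))"

lemma separated_pieces_finite:
  assumes "separated_pieces Z P V" "finite D" "D \<subseteq> P" "z \<in> topspace Z"
  shows "\<exists>z'\<in>topspace Z. (\<forall>c\<in>D. z' \<notin> V c) \<and> (\<forall>d\<in>P. z' \<in> V d \<longrightarrow> z \<in> V d)"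
  using assms(2,3)
proof (induction D rule: finite_induct)
  case empty
  then show ?case using assms(4) by auto
next
  case (insert c D)
  then obtain y where y: "y \<in> topspace Z" "\<forall>c\<in>D. y \<notin> V c" "\<forall>d\<in>P. y \<in> V d \<longrightarrow> z \<in> V d"
    by auto
  obtain z' where "z' \<in> topspace Z" "z' \<notin> V c" "\<forall>d\<in>P. z' \<in> V d \<longrightarrow> y \<in> V d"
    using assms(1) y(1) insert.prems unfolding separated_pieces_def by blast
  with y insert.prems show ?case by (intro bexI[of _ z']) auto
qed

lemma covering_minus_finite:
  assumes sep: "separated_pieces Z P V" and C: "C \<in> covering Z P V"
    and D: "finite D" "D \<subseteq> P"
  shows "C - D \<in> covering Z P V"
proof -
  have CP: "C \<subseteq> P" and cov: "topspace Z \<subseteq> (\<Union>c\<in>C. V c)"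
    using C unfolding covering_def by auto
  have "topspace Z \<subseteq> (\<Union>c\<in>C - D. V c)"
  proof
    fix z assume "z \<in> topspace Z"
    from separated_pieces_finite[OF sep D this] obtain z' where z': "z' \<in> topspace Z"
      "(\<forall>c\<in>D. z' \<notin> V c) \<and> (\<forall>d\<in>P. z' \<in> V d \<longrightarrow> z \<in> V d)" ..
    then have "z' \<in> (\<Union>c\<in>C. V c)" using cov by (simp only: subsetD)
    then obtain c where "c \<in> C" "z' \<in> V c" by auto
    then have "c \<in> C - D" "z \<in> V c" using z'(2) CP by auto
    then show "z \<in> (\<Union>c\<in>C - D. V c)" by (rule UN_I)
  qed
  with CP show ?thesis unfolding covering_def by auto
qed

lemma covering_infinite:
  assumes "separated_pieces Z P V" "topspace Z \<noteq> {}" "C \<in> covering Z P V"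
  shows "infinite C"
proof
  assume "finite C"
  moreover have "C \<subseteq> P" using assms(3) unfolding covering_def by simp
  ultimately have "C - C \<in> covering Z P V" by (rule covering_minus_finite[OF assms(1,3)])
  with assms(2) show False unfolding covering_def by simp
qed

text \<open>The tails \<open>{c i | i \<ge> m}\<close> of an enumeration remain coverings. A function \<open>g\<close> supplied by the Hurewicz
  property makes the finite blocks \<open>{c i | m \<le> i < g m}\<close> catch each point for all large \<open>m\<close>, and \<open>c i\<close>
  occurs in such a block only for \<open>m \<le> i\<close>.\<close>

lemma Hurewicz_countable_groupable:
  assumes H: "Hurewicz_space Z" and ne: "topspace Z \<noteq> {}"
    and opn: "\<And>c. c \<in> P \<Longrightarrow> openin Z (V c)"
    and sep: "separated_pieces Z P V"
    and C: "C \<in> covering Z P V" "countable C"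
  shows "C \<in> groupable (covering Z P V)"
proof -
  define c where "c = from_nat_into C"
  have bij: "bij_betw c UNIV C"
    unfolding c_def using bij_betw_from_nat_into C(2) covering_infinite[OF sep ne C(1)] by blast
  then have inj: "inj c" and ran: "range c = C" by (auto simp: bij_betw_def)
  have CP: "C \<subseteq> P" using C unfolding covering_def by blast
  define W where "W m i = (if i \<ge> m then V (c i) else {})" for m i
  have "openin Z (W m i)" for m i
    unfolding W_def using opn CP ran by auto
  moreover have "topspace Z \<subseteq> (\<Union>i. W m i)" for m
  proof
    fix z assume z: "z \<in> topspace Z"
    have "C - c ` {..<m} \<in> covering Z P V"
      by (rule covering_minus_finite[OF sep C(1)]) (use ran CP in auto)
    then obtain d where d: "d \<in> C - c ` {..<m}" "z \<in> V d" using z unfolding covering_def by auto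
    then have "d \<in> range c" using ran by simp
    then obtain i where i: "d = c i" by (rule rangeE)
    then have "\<not> i < m" using d(1) by auto
    then have "z \<in> W m i" using d(2) i unfolding W_def by simp
    then show "z \<in> (\<Union>i. W m i)" by (rule UN_I[OF UNIV_I])
  qed
  ultimately obtain g where g: "\<And>z. z \<in> topspace Z \<Longrightarrow> \<exists>m. \<forall>n\<ge>m. \<exists>i<g n. z \<in> W n i"
    using Hurewicz_select_nat[OF H, of W] by metis
  show ?thesis
  proof (rule groupable_coveringI[OF C, of "\<lambda>k. c ` {k..<g k}"])
    show "c ` {k..<g k} \<subseteq> C" for k using ran by auto
    show "finite {k. d \<in> c ` {k..<g k}}" if "d \<in> C" for d
    proof -
      obtain j where j: "d = c j" using \<open>d \<in> C\<close> ran by blast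
      have "{k. d \<in> c ` {k..<g k}} \<subseteq> {..j}" using inj unfolding j by (auto dest: injD)
      then show ?thesis by (rule finite_subset) simp
    qed
    show "\<exists>m. \<forall>k\<ge>m. \<exists>d\<in>c ` {k..<g k}. z \<in> V d" if z: "z \<in> topspace Z" for z
    proof -
      obtain m where "\<And>n. n \<ge> m \<Longrightarrow> \<exists>i<g n. z \<in> W n i" using g[OF z] by blast
      then have "\<forall>k\<ge>m. \<exists>d\<in>c ` {k..<g k}. z \<in> V d"
        unfolding W_def by (fastforce split: if_splits)
      then show ?thesis by blast
    qed
  qed simp
qed

section \<open>The game on a Gerlits-Nagy space\<close>

lemma countable_subcovering:
  assumes R: "Rothberger_space Z" and ne: "topspace Z \<noteq> {}"
    and opn: "\<And>c. c \<in> P \<Longrightarrow> openin Z (V c)"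
    and A: "A \<in> covering Z P V"
  shows "\<exists>e :: nat \<Rightarrow> 'c. range e \<subseteq> A \<and> range e \<in> covering Z P V"
proof -
  have A': "A \<noteq> {}" "topspace Z \<subseteq> (\<Union>c\<in>A. V c)" "A \<subseteq> P"
    using A ne unfolding covering_def by auto
  have A_opn: "openin Z (V c)" if "c \<in> A" for c using that opn A'(3) by auto
  obtain e where e: "\<And>n::nat. e n \<in> A" "\<And>z. z \<in> topspace Z \<Longrightarrow> \<exists>n. z \<in> V (e n)"
    by (rule Rothberger_select[OF R A'(1) A_opn A'(2)]) (assumption, rule that)
  have "range e \<subseteq> A" using e(1) by auto
  moreover have "range e \<in> covering Z P V"
    unfolding covering_def using e(2) \<open>range e \<subseteq> A\<close> A'(3) by auto
  ultimately show ?thesis by (intro exI conjI)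
qed

text \<open>This follows Pawlikowski's argument for the Rothberger game, which the Hurewicz property makes
  short. One may be assumed to offer enumerated coverings, so that positions are finite sequences of numbers.
  The Hurewicz property provides bounds \<open>B k\<close> such that each point \<open>z\<close>, for all large \<open>k\<close>, lies at every
  position of length \<open>k\<close> with entries below \<open>B k\<close> in one of the first \<open>B (Suc k)\<close> pieces on offer.
  A move function \<open>h\<close> on these finitely many positions defines the open set \<open>N k h\<close> of the points caught by
  \<open>h\<close> whatever the position is. The sets \<open>N k h\<close> with \<open>h\<close> below \<open>B (Suc k)\<close> contain each point for all
  large \<open>k\<close>, which is what the refined Rothberger selection requires. The selected move functions
  determine a branch, and a point caught by the \<open>k\<close>-th of them is caught by the \<open>k\<close>-th move of that branch.
  So the moves along the branch form a covering, and countable coverings are groupable.\<close>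

lemma One_no_winning_strategy:
  fixes Z :: "'z topology" and P :: "'c set"
  assumes H: "Hurewicz_space Z" and R: "Rothberger_space Z" and ne: "topspace Z \<noteq> {}"
    and opn: "\<And>c. c \<in> P \<Longrightarrow> openin Z (V c)"
    and sep: "separated_pieces Z P V"
  shows "\<not> winning_strategy_One (covering Z P V) (groupable (covering Z P V)) \<sigma>"
proof
  let ?H = "covering Z P V"
  assume win: "winning_strategy_One ?H (groupable ?H) \<sigma>"
  have "strategy_One ?H \<sigma>" using win unfolding winning_strategy_One_def by (rule conjunct1)
  then have strat: "\<And>s. s \<in> lists (\<Union>?H) \<Longrightarrow> \<sigma> s \<in> ?H"
    unfolding strategy_One_def by (rule bspec)
  have lost: "range x \<notin> groupable ?H" if "\<And>n. x n \<in> \<sigma> (map x [0..<n])" for x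
    by (rule win[unfolded winning_strategy_One_def, THEN conjunct2, rule_format, OF that])
  have "\<forall>s\<in>lists (\<Union>?H). \<exists>e :: nat \<Rightarrow> 'c. range e \<subseteq> \<sigma> s \<and> range e \<in> ?H"
    using countable_subcovering[OF R ne opn strat] by simp
  from bchoice[OF this] obtain e :: "'c list \<Rightarrow> nat \<Rightarrow> 'c"
    where e: "\<forall>s\<in>lists (\<Union>?H). range (e s) \<subseteq> \<sigma> s \<and> range (e s) \<in> ?H" ..
  \<comment> \<open>The position reached when Two's successive answers are the numbers in the list.\<close>
  define p where "p \<iota> = foldl (\<lambda>s i. s @ [e s i]) [] \<iota>" for \<iota>
  have p_snoc: "p (\<iota> @ [i]) = p \<iota> @ [e (p \<iota>) i]" for \<iota> i
    by (simp add: p_def)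
  have p: "p \<iota> \<in> lists (\<Union>?H)" for \<iota>
  proof (induction \<iota> rule: rev_induct)
    case Nil
    then show ?case by (simp add: p_def)
  next
    case (snoc i \<iota>)
    have "e (p \<iota>) i \<in> \<Union>?H" using e[rule_format, OF snoc] by (intro UnionI[of "range (e (p \<iota>))"]) auto
    with snoc show ?case unfolding p_snoc by simp
  qed
  have eP: "e (p \<iota>) i \<in> P" for \<iota> i using e[rule_format, OF p, of \<iota>] unfolding covering_def by auto
  have ecov: "\<exists>i. z \<in> V (e (p \<iota>) i)" if "z \<in> topspace Z" for z \<iota>
    using e[rule_format, OF p, of \<iota>] that unfolding covering_def by auto
  define S where "S m = {\<iota>. set \<iota> \<subseteq> {..<m} \<and> length \<iota> \<le> m}" for m :: nat
  have finS: "finite (S m)" for m unfolding S_def by (rule finite_lists_length_le) simp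
  \<comment> \<open>Points for which the first \<open>j\<close> pieces suffice at every position of size at most \<open>m\<close>.\<close>
  define W where "W m j = (\<Inter>\<iota>\<in>S m. \<Union>i<j. V (e (p \<iota>) i)) \<inter> topspace Z" for m j
  have "openin Z (W m j)" for m j
    unfolding W_def using opn eP by (intro openin_INT openin_Union finS) blast
  moreover have "topspace Z \<subseteq> (\<Union>j. W m j)" for m
  proof
    fix z assume z: "z \<in> topspace Z"
    obtain h where h: "\<And>\<iota>. z \<in> V (e (p \<iota>) (h \<iota>))"
      using choice[of "\<lambda>\<iota> i. z \<in> V (e (p \<iota>) i)"] ecov[OF z] by blast
    have "finite (h ` S m)" using finS by simp
    then obtain j where "\<forall>i\<in>h ` S m. i < j" unfolding finite_nat_set_iff_bounded by blast
    then have "\<exists>i<j. z \<in> V (e (p \<iota>) i)" if "\<iota> \<in> S m" for \<iota> using h that by blast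
    then have "z \<in> W m j" unfolding W_def using z by blast
    then show "z \<in> (\<Union>j. W m j)" by blast
  qed
  ultimately obtain g where g: "\<And>z. z \<in> topspace Z \<Longrightarrow> \<exists>m. \<forall>n\<ge>m. \<exists>j<g n. z \<in> W n j"
    using Hurewicz_select_nat[OF H, of W] by metis
  have W_mono: "W m j \<subseteq> W m k" if "j \<le> k" for m j k
    using that less_le_trans unfolding W_def by blast
  define B where "B = rec_nat 0 (\<lambda>_ b. max (g b) (Suc b))"
  have BS: "B (Suc k) = max (g (B k)) (Suc (B k))" for k by (simp add: B_def)
  have sm: "strict_mono B" unfolding strict_mono_Suc_iff BS by (simp add: less_max_iff_disj)
  define T where "T k = {\<iota>. set \<iota> \<subseteq> {..<B k} \<and> length \<iota> = k}" for k
  have finT: "finite (T k)" for k unfolding T_def by (rule finite_lists_length_eq) simp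
  have TS: "T k \<subseteq> S (B k)" for k
    using strict_mono_imp_increasing[OF sm, of k] unfolding S_def T_def by auto
  define N where "N k h = (\<Inter>\<iota>\<in>T k. V (e (p \<iota>) (h \<iota>))) \<inter> topspace Z" for k h
  define \<V> where "\<V> k = N k ` {h. \<forall>\<iota>\<in>T k. h \<iota> < B (Suc k)}" for k
  obtain U where U: "\<And>k. U k \<in> \<V> k" "\<And>z. z \<in> topspace Z \<Longrightarrow> \<exists>k. z \<in> U k"
  proof (rule Rothberger_select_frequently[OF R, of \<V>])
    fix k
    have "0 < B (Suc k)" unfolding BS by simp
    then have "N k (\<lambda>_. 0) \<in> \<V> k" unfolding \<V>_def by auto
    then show "\<V> k \<noteq> {}" by blast
  next
    fix k U assume "U \<in> \<V> k"
    then obtain h where "U = N k h" unfolding \<V>_def by blast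
    then show "openin Z U" unfolding N_def using opn eP finT by auto
  next
    fix z assume z: "z \<in> topspace Z"
    then obtain m where m: "\<And>n. n \<ge> m \<Longrightarrow> \<exists>j<g n. z \<in> W n j" using g by blast
    have "z \<in> \<Union>(\<V> k)" if k: "k \<ge> m" for k
    proof -
      have "B k \<ge> m" using strict_mono_imp_increasing[OF sm, of k] k by simp
      then obtain j where j: "j < g (B k)" "z \<in> W (B k) j" using m by blast
      have "j \<le> B (Suc k)" using j(1) unfolding BS by simp
      then have "z \<in> W (B k) (B (Suc k))" using j(2) W_mono by blast
      then have "\<forall>\<iota>\<in>T k. \<exists>i<B (Suc k). z \<in> V (e (p \<iota>) i)"
        using TS[of k] unfolding W_def by blast
      then obtain h where h: "\<forall>\<iota>\<in>T k. h \<iota> < B (Suc k) \<and> z \<in> V (e (p \<iota>) (h \<iota>))"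
        using bchoice[of "T k" "\<lambda>\<iota> i. i < B (Suc k) \<and> z \<in> V (e (p \<iota>) i)"] by blast
      then have "z \<in> N k h" "N k h \<in> \<V> k" unfolding N_def \<V>_def using z by auto
      then show ?thesis by blast
    qed
    then have "{m..} \<subseteq> {k. z \<in> \<Union>(\<V> k)}" by auto
    then show "infinite {k. z \<in> \<Union>(\<V> k)}" using infinite_Ici infinite_super by blast
  qed (rule that)
  have "\<forall>k. \<exists>h. (\<forall>\<iota>\<in>T k. h \<iota> < B (Suc k)) \<and> U k = N k h" using U(1) unfolding \<V>_def by blast
  then obtain h where h: "\<And>k \<iota>. \<iota> \<in> T k \<Longrightarrow> h k \<iota> < B (Suc k)" "\<And>k. U k = N k (h k)"
    using choice[of "\<lambda>k h. (\<forall>\<iota>\<in>T k. h \<iota> < B (Suc k)) \<and> U k = N k h"] by blast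
  \<comment> \<open>The branch obtained by obeying the selected move functions.\<close>
  define b where "b = rec_nat [] (\<lambda>k \<iota>. \<iota> @ [h k \<iota>])"
  have b0: "b 0 = []" and bS: "b (Suc k) = b k @ [h k (b k)]" for k by (simp_all add: b_def)
  have bT: "b k \<in> T k" for k
  proof (induction k)
    case (Suc k)
    have "B k \<le> B (Suc k)" using sm by (simp add: strict_mono_less_eq)
    then show ?case using Suc h(1)[OF Suc] unfolding bS T_def by auto
  qed (simp add: b0 T_def)
  define c where "c k = e (p (b k)) (h k (b k))" for k
  have play: "p (b k) = map c [0..<k]" for k
  proof (induction k)
    case 0
    then show ?case by (simp add: b0 p_def)
  next
    case (Suc k)
    then show ?case by (simp add: bS p_snoc c_def)
  qed
  have "c k \<in> \<sigma> (map c [0..<k])" for k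
    using e[rule_format, OF p, of "b k"] unfolding play[symmetric] c_def by auto
  then have "range c \<notin> groupable ?H" by (rule lost)
  moreover have "range c \<in> ?H"
  proof -
    have "z \<in> (\<Union>k. V (c k))" if z: "z \<in> topspace Z" for z
    proof -
      obtain k where "z \<in> U k" using U(2) z by blast
      then have "z \<in> V (c k)" using bT[of k] unfolding h(2) N_def c_def by auto
      then show ?thesis by blast
    qed
    then show ?thesis unfolding covering_def c_def using eP by auto
  qed
  then have "range c \<in> groupable ?H"
    using Hurewicz_countable_groupable[OF H ne opn sep] by simp
  ultimately show False by blast
qed

section \<open>Groupable selection principles\<close>

text \<open>A sequence in \<open>\<A>\<close> is a strategy that looks only at the number of the inning; a play lost by One is
  the required selection.\<close>

lemma no_winning_strategy_imp_S1:
  assumes "\<nexists>\<sigma>. winning_strategy_One \<A> \<B> \<sigma>"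
  shows "S1 \<A> \<B>"
  unfolding S1_def
proof (intro allI impI)
  fix U :: "nat \<Rightarrow> 'a set" assume U: "\<forall>n. U n \<in> \<A>"
  then have "strategy_One \<A> (\<lambda>s. U (length s))" unfolding strategy_One_def by blast
  moreover have "\<not> winning_strategy_One \<A> \<B> (\<lambda>s. U (length s))" using assms by blast
  ultimately show "\<exists>x. (\<forall>n. x n \<in> U n) \<and> range x \<in> \<B>"
    unfolding winning_strategy_One_def by auto
qed

lemma S1_groupable_imp_S1:
  assumes "S1 \<CC> (groupable \<CC>)"
  shows "S1 \<CC> \<CC>"
  using assms unfolding S1_def groupable_def by blast

text \<open>Selecting from the constant sequence \<open>C\<close> gives a groupable part of \<open>C\<close>. The remaining
  elements can be added to the groups one at a time, since \<open>\<CC>\<close> contains what lies between two members.\<close>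

lemma S1_groupable_imp_countable_groupable:
  assumes S: "S1 \<CC> (groupable \<CC>)"
    and between: "\<And>C D E. C \<in> \<CC> \<Longrightarrow> E \<in> \<CC> \<Longrightarrow> C \<subseteq> D \<Longrightarrow> D \<subseteq> E \<Longrightarrow> D \<in> \<CC>"
    and C: "C \<in> \<CC>" "countable C"
  shows "C \<in> groupable \<CC>"
proof -
  obtain x where x: "\<And>n::nat. x n \<in> C" "range x \<in> groupable \<CC>"
    using S[unfolded S1_def, rule_format, of "\<lambda>_. C"] C(1) by blast
  then obtain \<phi> :: "'a \<Rightarrow> nat" where \<phi>: "\<And>n. finite {c \<in> range x. \<phi> c = n}"
    "\<And>J. infinite J \<Longrightarrow> (\<Union>n\<in>J. {c \<in> range x. \<phi> c = n}) \<in> \<CC>"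
    unfolding groupable_def by blast
  define \<psi> where "\<psi> c = (if c \<in> range x then \<phi> c else to_nat_on C c)" for c
  have "finite {c \<in> C. \<psi> c = n}" for n
  proof (rule finite_subset)
    show "{c \<in> C. \<psi> c = n} \<subseteq> {c \<in> range x. \<phi> c = n} \<union> {from_nat_into C n}"
    proof
      fix c assume c: "c \<in> {c \<in> C. \<psi> c = n}"
      show "c \<in> {c \<in> range x. \<phi> c = n} \<union> {from_nat_into C n}"
      proof (cases "c \<in> range x")
        case True
        with c show ?thesis unfolding \<psi>_def by simp
      next
        case False
        with c have "to_nat_on C c = n" "c \<in> C" unfolding \<psi>_def by auto
        then show ?thesis using from_nat_into_to_nat_on[OF C(2), of c] by simp
      qed
    qed
    show "finite ({c \<in> range x. \<phi> c = n} \<union> {from_nat_into C n})" using \<phi>(1) by auto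
  qed
  moreover have "(\<Union>n\<in>J. {c \<in> C. \<psi> c = n}) \<in> \<CC>" if J: "infinite J" for J
    by (rule between[OF \<phi>(2)[OF J] C(1)]) (use x(1) in \<open>auto simp: \<psi>_def\<close>)
  ultimately show ?thesis by (intro groupableI[OF C(1), of \<psi>])
qed

lemma S1_groupableI:
  assumes "S1 \<CC> \<CC>" and "\<And>C. C \<in> \<CC> \<Longrightarrow> countable C \<Longrightarrow> C \<in> groupable \<CC>"
  shows "S1 \<CC> (groupable \<CC>)"
  using assms unfolding S1_def by (metis countableI_type countable_image)

section \<open>Sums and images of Gerlits-Nagy spaces\<close>

text \<open>For Hurewicz, stage \<open>n\<close> uses the finite choices made for the summands numbered up to \<open>n\<close>, and each summand takes
  part from some stage on. For Rothberger, the stages are split into infinitely many infinite sets, one for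
  each summand.\<close>

lemma Gerlits_Nagy_sum_topology:
  assumes I: "countable I" and ne: "topspace (sum_topology Z I) \<noteq> {}"
    and GN: "\<And>i. i \<in> I \<Longrightarrow> Gerlits_Nagy_space (Z i)"
  shows "Gerlits_Nagy_space (sum_topology Z I)"
  unfolding Gerlits_Nagy_space_def
proof
  let ?S = "sum_topology Z I"
  have opn: "openin (Z i) {x. (i, x) \<in> U}" if "\<U> \<in> open_covers ?S" "U \<in> \<U>" "i \<in> I" for \<U> U i
    using that unfolding open_covers_def proper_opens_def by (auto simp: openin_sum_topology)
  have cov: "topspace (Z i) \<subseteq> (\<Union>U\<in>\<U>. {x. (i, x) \<in> U})" if "\<U> \<in> open_covers ?S" "i \<in> I" for \<U> i
  proof
    fix x assume "x \<in> topspace (Z i)"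
    then have "(i, x) \<in> \<Union>\<U>" using that unfolding open_covers_def by simp
    then show "x \<in> (\<Union>U\<in>\<U>. {x. (i, x) \<in> U})" by blast
  qed
  have nonempty: "\<U> \<noteq> {}" if "\<U> \<in> open_covers ?S" for \<U>
    by (rule open_cover_nonempty[OF that ne])
  show "Hurewicz_space ?S"
    unfolding Hurewicz_space_def
  proof (intro allI impI)
    fix \<U> :: "nat \<Rightarrow> ('a \<times> 'b) set set" assume \<U>: "\<forall>n. \<U> n \<in> open_covers ?S"
    have "\<forall>i\<in>I. \<exists>F. (\<forall>n. finite (F n) \<and> F n \<subseteq> \<U> n) \<and>
        (\<forall>x\<in>topspace (Z i). \<exists>m. \<forall>n\<ge>m. \<exists>U\<in>F n. (i, x) \<in> U)"
    proof
      fix i assume i: "i \<in> I"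
      have H: "Hurewicz_space (Z i)" using GN[OF i] unfolding Gerlits_Nagy_space_def by blast
      show "\<exists>F. (\<forall>n. finite (F n) \<and> F n \<subseteq> \<U> n) \<and>
        (\<forall>x\<in>topspace (Z i). \<exists>m. \<forall>n\<ge>m. \<exists>U\<in>F n. (i, x) \<in> U)"
      proof (rule Hurewicz_select[OF H, of \<U> "\<lambda>_ U. {x. (i, x) \<in> U}"])
        show "openin (Z i) {x. (i, x) \<in> U}" if "U \<in> \<U> n" for n U using opn \<U> that i by metis
        show "topspace (Z i) \<subseteq> (\<Union>U\<in>\<U> n. {x. (i, x) \<in> U})" for n using cov \<U> i by metis
        fix F assume F: "\<And>n. finite (F n)" "\<And>n. F n \<subseteq> \<U> n"
          "\<And>x. x \<in> topspace (Z i) \<Longrightarrow> \<exists>m. \<forall>n\<ge>m. \<exists>U\<in>F n. x \<in> {x. (i, x) \<in> U}"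
        show ?thesis by (rule exI[of _ F]) (use F in auto)
      qed
    qed
    from bchoice[OF this] obtain F where F: "\<forall>i\<in>I. (\<forall>n. finite (F i n) \<and> F i n \<subseteq> \<U> n) \<and>
        (\<forall>x\<in>topspace (Z i). \<exists>m. \<forall>n\<ge>m. \<exists>U\<in>F i n. (i, x) \<in> U)" ..
    define U0 where "U0 n = (SOME U. U \<in> \<U> n)" for n
    have U0: "U0 n \<in> \<U> n" for n
      unfolding U0_def using nonempty \<U> by (simp add: some_in_eq)
    define J where "J n = {i \<in> I. to_nat_on I i \<le> n}" for n
    have J: "finite (J n)" for n
    proof (rule finite_imageD)
      show "finite (to_nat_on I ` J n)" by (rule finite_subset[of _ "{..n}"]) (auto simp: J_def)
      show "inj_on (to_nat_on I) (J n)"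
        by (rule inj_on_subset[OF inj_on_to_nat_on[OF I]]) (auto simp: J_def)
    qed
    define \<F> where "\<F> n = insert (U0 n) (\<Union>i\<in>J n. F i n)" for n
    show "\<exists>\<F>. (\<forall>n. \<F> n \<in> fin_subsets (\<U> n)) \<and>
        (\<forall>z\<in>topspace ?S. \<exists>m. \<forall>n\<ge>m. z \<in> \<Union> (\<F> n))"
    proof (intro exI[of _ \<F>] conjI allI ballI)
      have FJ: "finite (F i n) \<and> F i n \<subseteq> \<U> n" if "i \<in> J n" for i n
        using F[THEN bspec, of i, THEN conjunct1, THEN spec, of n] that unfolding J_def by simp
      show "\<F> n \<in> fin_subsets (\<U> n)" for n
        using U0[of n] J[of n] FJ[of _ n] unfolding \<F>_def fin_subsets_def by auto
      fix z assume "z \<in> topspace ?S"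
      then obtain i x where z: "z = (i, x)" "i \<in> I" "x \<in> topspace (Z i)" by auto
      obtain m where m: "\<forall>n\<ge>m. \<exists>U\<in>F i n. (i, x) \<in> U"
        using F[THEN bspec, OF z(2), THEN conjunct2, THEN bspec, OF z(3)] ..
      have "z \<in> \<Union> (\<F> n)" if "n \<ge> max m (to_nat_on I i)" for n
      proof -
        obtain U where "U \<in> F i n" "(i, x) \<in> U" using m \<open>n \<ge> _\<close> by auto
        moreover have "i \<in> J n" using that z unfolding J_def by auto
        ultimately show ?thesis unfolding \<F>_def z by auto
      qed
      then show "\<exists>m. \<forall>n\<ge>m. z \<in> \<Union> (\<F> n)" by blast
    qed
  qed
  show "Rothberger_space ?S"
    unfolding Rothberger_space_def S1_def
  proof (intro allI impI)
    fix \<U> :: "nat \<Rightarrow> ('a \<times> 'b) set set" assume \<U>: "\<forall>n. \<U> n \<in> open_covers ?S"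
    have Ine: "I \<noteq> {}" using ne by auto
    define i where "i = from_nat_into I"
    have i: "i k \<in> I" for k unfolding i_def by (rule from_nat_into[OF Ine])
    have "\<forall>k. \<exists>c. (\<forall>m. c m \<in> \<U> (prod_encode (k, m))) \<and>
        (\<forall>x\<in>topspace (Z (i k)). \<exists>m. (i k, x) \<in> c m)"
    proof
      fix k
      have R: "Rothberger_space (Z (i k))" using GN[OF i] unfolding Gerlits_Nagy_space_def by blast
      show "\<exists>c. (\<forall>m. c m \<in> \<U> (prod_encode (k, m))) \<and>
        (\<forall>x\<in>topspace (Z (i k)). \<exists>m. (i k, x) \<in> c m)"
      proof (rule Rothberger_select[OF R, of "\<lambda>m. \<U> (prod_encode (k, m))" "\<lambda>_ U. {x. (i k, x) \<in> U}"])
        show "\<U> (prod_encode (k, m)) \<noteq> {}" for m using nonempty \<U> by simp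
        show "openin (Z (i k)) {x. (i k, x) \<in> U}" if "U \<in> \<U> (prod_encode (k, m))" for m U
          using opn \<U> that i by metis
        show "topspace (Z (i k)) \<subseteq> (\<Union>U\<in>\<U> (prod_encode (k, m)). {x. (i k, x) \<in> U})" for m
          using cov \<U> i by metis
        fix c assume c: "\<And>m. c m \<in> \<U> (prod_encode (k, m))"
          "\<And>x. x \<in> topspace (Z (i k)) \<Longrightarrow> \<exists>m. x \<in> {x. (i k, x) \<in> c m}"
        show ?thesis by (rule exI[of _ c]) (use c in auto)
      qed
    qed
    from choice[OF this] obtain c where c: "\<forall>k. (\<forall>m. c k m \<in> \<U> (prod_encode (k, m))) \<and>
        (\<forall>x\<in>topspace (Z (i k)). \<exists>m. (i k, x) \<in> c k m)" ..
    define U where "U n = c (fst (prod_decode n)) (snd (prod_decode n))" for n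
    have U: "U n \<in> \<U> n" for n
      using c[rule_format, THEN conjunct1, rule_format, of "fst (prod_decode n)" "snd (prod_decode n)"]
      unfolding U_def by simp
    have "\<exists>n. z \<in> U n" if "z \<in> topspace ?S" for z
    proof -
      obtain j x where z: "z = (j, x)" "j \<in> I" "x \<in> topspace (Z j)"
        using \<open>z \<in> topspace ?S\<close> by (cases z) simp
      have j: "i (to_nat_on I j) = j" unfolding i_def using I z(2) by simp
      have "\<forall>x\<in>topspace (Z j). \<exists>m. (j, x) \<in> c (to_nat_on I j) m"
        using c[rule_format, THEN conjunct2, of "to_nat_on I j"] unfolding j .
      then obtain m where "(j, x) \<in> c (to_nat_on I j) m" using z by auto
      then have "z \<in> U (prod_encode (to_nat_on I j, m))" unfolding U_def z by simp
      then show ?thesis by (rule exI)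
    qed
    then have "topspace ?S \<subseteq> \<Union>(range U)" by auto
    moreover have "range U \<subseteq> proper_opens ?S" using U \<U> unfolding open_covers_def by auto
    ultimately have "range U \<in> open_covers ?S" by (simp only: open_covers_iff simp_thms)
    then show "\<exists>x. (\<forall>n. x n \<in> \<U> n) \<and> range x \<in> open_covers ?S"
      using U by (intro exI[of _ U]) auto
  qed
qed

lemma Gerlits_Nagy_continuous_image:
  assumes GN: "Gerlits_Nagy_space Z" and f: "continuous_map Z Y f" "f ` topspace Z = topspace Y"
    and ne: "topspace Y \<noteq> {}"
  shows "Gerlits_Nagy_space Y"
  unfolding Gerlits_Nagy_space_def
proof
  have H: "Hurewicz_space Z" and R: "Rothberger_space Z"
    using GN unfolding Gerlits_Nagy_space_def by auto
  let ?V = "\<lambda>_ U. {x \<in> topspace Z. f x \<in> U}"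
  have opn: "openin Z {x \<in> topspace Z. f x \<in> U}" if "\<U> \<in> open_covers Y" "U \<in> \<U>" for \<U> U
    using that openin_continuous_map_preimage[OF f(1)]
    unfolding open_covers_def proper_opens_def by auto
  have cov: "topspace Z \<subseteq> (\<Union>U\<in>\<U>. {x \<in> topspace Z. f x \<in> U})" if "\<U> \<in> open_covers Y" for \<U>
  proof
    fix x assume x: "x \<in> topspace Z"
    then have "f x \<in> \<Union>\<U>" using that f(2) unfolding open_covers_def by auto
    with x show "x \<in> (\<Union>U\<in>\<U>. {x \<in> topspace Z. f x \<in> U})" by auto
  qed
  have nonempty: "\<U> \<noteq> {}" if "\<U> \<in> open_covers Y" for \<U>
    by (rule open_cover_nonempty[OF that ne])
  show "Hurewicz_space Y"
    unfolding Hurewicz_space_def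
  proof (intro allI impI)
    fix \<U> :: "nat \<Rightarrow> 'b set set" assume \<U>: "\<forall>n. \<U> n \<in> open_covers Y"
    define U0 where "U0 n = (SOME U. U \<in> \<U> n)" for n
    have U0: "U0 n \<in> \<U> n" for n
      unfolding U0_def using nonempty \<U> by (simp add: some_in_eq)
    show "\<exists>\<F>. (\<forall>n. \<F> n \<in> fin_subsets (\<U> n)) \<and> (\<forall>z\<in>topspace Y. \<exists>m. \<forall>n\<ge>m. z \<in> \<Union> (\<F> n))"
    proof (rule Hurewicz_select[OF H, of \<U> ?V])
      show "openin Z (?V n U)" if "U \<in> \<U> n" for n U using opn \<U> that by metis
      show "topspace Z \<subseteq> (\<Union>U\<in>\<U> n. ?V n U)" for n using cov \<U> by metis
      fix F assume F: "\<And>n. finite (F n)" "\<And>n. F n \<subseteq> \<U> n"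
          "\<And>x. x \<in> topspace Z \<Longrightarrow> \<exists>m. \<forall>n\<ge>m. \<exists>U\<in>F n. x \<in> ?V n U"
      show ?thesis
      proof (intro exI[of _ "\<lambda>n. insert (U0 n) (F n)"] conjI allI ballI)
        show "insert (U0 n) (F n) \<in> fin_subsets (\<U> n)" for n
          using F(1,2) U0 unfolding fin_subsets_def by auto
        fix y assume "y \<in> topspace Y"
        then obtain x where x: "x \<in> topspace Z" "y = f x" using f(2) by auto
        obtain m where "\<forall>n\<ge>m. \<exists>U\<in>F n. x \<in> ?V n U" using F(3)[OF x(1)] ..
        then have "\<forall>n\<ge>m. y \<in> \<Union> (insert (U0 n) (F n))" using x(2) by auto
        then show "\<exists>m. \<forall>n\<ge>m. y \<in> \<Union> (insert (U0 n) (F n))" ..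
      qed
    qed
  qed
  show "Rothberger_space Y"
    unfolding Rothberger_space_def S1_def
  proof (intro allI impI)
    fix \<U> :: "nat \<Rightarrow> 'b set set" assume \<U>: "\<forall>n. \<U> n \<in> open_covers Y"
    show "\<exists>x. (\<forall>n. x n \<in> \<U> n) \<and> range x \<in> open_covers Y"
    proof (rule Rothberger_select[OF R, of \<U> ?V])
      show "\<U> n \<noteq> {}" for n using nonempty \<U> by simp
      show "openin Z (?V n U)" if "U \<in> \<U> n" for n U using opn \<U> that by metis
      show "topspace Z \<subseteq> (\<Union>U\<in>\<U> n. ?V n U)" for n using cov \<U> by metis
      fix c assume c: "\<And>n. c n \<in> \<U> n" "\<And>x. x \<in> topspace Z \<Longrightarrow> \<exists>n. x \<in> ?V n (c n)"
      have c_opens: "range c \<subseteq> proper_opens Y" using c(1) \<U> unfolding open_covers_def by auto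
      have "topspace Y \<subseteq> \<Union>(range c)"
      proof
        fix y assume "y \<in> topspace Y"
        then obtain x where x: "x \<in> topspace Z" "y = f x" using f(2) by auto
        obtain n where "x \<in> ?V n (c n)" using c(2)[OF x(1)] ..
        then show "y \<in> \<Union>(range c)" using x(2) by auto
      qed
      with c_opens have "range c \<in> open_covers Y" by (simp only: open_covers_iff simp_thms)
      then show ?thesis using c(1) by (intro exI[of _ c]) auto
    qed
  qed
qed

lemma continuous_map_from_sum_topology:
  assumes "\<And>i. i \<in> I \<Longrightarrow> continuous_map (Z i) Y (\<lambda>x. f (i, x))"
  shows "continuous_map (sum_topology Z I) Y f"
  unfolding continuous_map_def
proof (intro conjI allI impI)
  show "f \<in> topspace (sum_topology Z I) \<rightarrow> topspace Y"
    using assms unfolding continuous_map_def by (auto simp: Pi_iff)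
  fix U assume U: "openin Y U"
  have "openin (Z i) {x. (i, x) \<in> {z \<in> topspace (sum_topology Z I). f z \<in> U}}" if "i \<in> I" for i
    using openin_continuous_map_preimage[OF assms[OF that] U] that by simp
  then show "openin (sum_topology Z I) {z \<in> topspace (sum_topology Z I). f z \<in> U}"
    unfolding openin_sum_topology by auto
qed

section \<open>Finite powers and the space of finite subsets\<close>

lemma topspace_finite_power: "topspace (finite_power X n) = ({..<n} \<rightarrow>\<^sub>E topspace X)"
  unfolding finite_power_def by simp

lemma continuous_map_finite_power_component:
  "j < n \<Longrightarrow> continuous_map (finite_power X n) X (\<lambda>x. x j)"
  unfolding finite_power_def by (rule continuous_map_product_projection) simp

lemma finite_power_obtain:
  assumes "finite F" "F \<subseteq> topspace X"
  obtains x where "x \<in> topspace (finite_power X (card F))" "x ` {..<card F} = F"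
proof -
  obtain h where h: "bij_betw h {0..<card F} F" using ex_bij_betw_nat_finite[OF assms(1)] by blast
  let ?x = "restrict h {..<card F}"
  have im: "?x ` {..<card F} = F"
    using h unfolding bij_betw_def by (simp add: atLeast0LessThan)
  moreover have "?x \<in> topspace (finite_power X (card F))"
    unfolding topspace_finite_power using im assms(2) by (intro restrict_PiE_iff[THEN iffD2]) auto
  ultimately show ?thesis using that by blast
qed

lemma openin_Pfin_subsets:
  assumes "openin X U"
  shows "openin (Pfin X) {F \<in> fin_subsets (topspace X). F \<subseteq> U}"
proof -
  have "openin (Vietoris X) {K \<in> nonempty_compacts X. K \<subseteq> U}"
    unfolding Vietoris_def by (rule topology_generated_by_Basis) (use assms in blast)
  moreover have "{F \<in> fin_subsets (topspace X). F \<subseteq> U} =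
      {K \<in> nonempty_compacts X. K \<subseteq> U} \<inter> fin_subsets (topspace X)"
    using topspace_Pfin[of X] topspace_Vietoris[of X] unfolding Pfin_def topspace_subtopology by auto
  ultimately show ?thesis unfolding Pfin_def openin_subtopology by blast
qed

lemma continuous_map_image_Pfin:
  assumes A: "A \<subseteq> {..<n}" "A \<noteq> {}"
  shows "continuous_map (finite_power X n) (Pfin X) (\<lambda>x. x ` A)"
proof -
  have finA: "finite A" using A(1) finite_subset by blast
  have sub: "x ` A \<in> fin_subsets (topspace X)" if "x \<in> topspace (finite_power X n)" for x
    using that A finA unfolding topspace_finite_power fin_subsets_def by (auto simp: PiE_iff)
  have pre: "openin (finite_power X n) {x \<in> topspace (finite_power X n). x j \<in> U}"
    if "j \<in> A" "openin X U" for j U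
    by (rule openin_continuous_map_preimage[OF continuous_map_finite_power_component])
      (use that A in auto)
  have sub': "x ` A \<in> nonempty_compacts X" if "x \<in> topspace (finite_power X n)" for x
    using sub[OF that] topspace_Pfin[of X] topspace_Vietoris[of X]
    unfolding Pfin_def topspace_subtopology by auto
  have "continuous_map (finite_power X n) (Vietoris X) (\<lambda>x. x ` A)"
    unfolding Vietoris_def
  proof (rule continuous_on_generated_topo)
    let ?P = "finite_power X n"
    fix W assume "W \<in> {{K \<in> nonempty_compacts X. K \<subseteq> U} |U. openin X U} \<union>
      {{K \<in> nonempty_compacts X. K \<inter> U \<noteq> {}} |U. openin X U}"
    then consider U where "openin X U" "W = {K \<in> nonempty_compacts X. K \<subseteq> U}"
      | U where "openin X U" "W = {K \<in> nonempty_compacts X. K \<inter> U \<noteq> {}}" by blast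
    then show "openin ?P ((\<lambda>x. x ` A) -` W \<inter> topspace ?P)"
    proof cases
      case 1
      have "(\<lambda>x. x ` A) -` W \<inter> topspace ?P = (\<Inter>j\<in>A. {x \<in> topspace ?P. x j \<in> U}) \<inter> topspace ?P"
        using sub' unfolding 1(2) by auto
      moreover have "openin ?P ((\<Inter>j\<in>A. {x \<in> topspace ?P. x j \<in> U}) \<inter> topspace ?P)"
        using pre 1(1) finA by (intro openin_INT) auto
      ultimately show ?thesis by simp
    next
      case 2
      have "(\<lambda>x. x ` A) -` W \<inter> topspace ?P = (\<Union>j\<in>A. {x \<in> topspace ?P. x j \<in> U})"
        using sub' unfolding 2(2) by auto
      moreover have "openin ?P (\<Union>j\<in>A. {x \<in> topspace ?P. x j \<in> U})"
        using pre 2(1) by (intro openin_Union) auto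
      ultimately show ?thesis by simp
    qed
  next
    have "topspace (Vietoris X) = \<Union>({{K \<in> nonempty_compacts X. K \<subseteq> U} |U. openin X U} \<union>
      {{K \<in> nonempty_compacts X. K \<inter> U \<noteq> {}} |U. openin X U})"
      unfolding Vietoris_def topology_generated_by_topspace ..
    then show "(\<lambda>x. x ` A) ` topspace (finite_power X n) \<subseteq>
      \<Union>({{K \<in> nonempty_compacts X. K \<subseteq> U} |U. openin X U} \<union>
        {{K \<in> nonempty_compacts X. K \<inter> U \<noteq> {}} |U. openin X U})"
      using sub' unfolding topspace_Vietoris by auto
  qed
  then show ?thesis
    unfolding Pfin_def continuous_map_in_subtopology using sub by auto
qed

text \<open>\<open>Pfin X\<close> is the image of the sum of all positive finite powers under taking the set of
  coordinates.\<close>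

lemma Gerlits_Nagy_Pfin:
  assumes GN: "\<And>n. n \<ge> 1 \<Longrightarrow> Gerlits_Nagy_space (finite_power X n)" and ne: "topspace X \<noteq> {}"
  shows "Gerlits_Nagy_space (Pfin X)"
proof (rule Gerlits_Nagy_continuous_image)
  let ?S = "sum_topology (finite_power X) {1..}"
  let ?f = "\<lambda>(n, x). x ` {..<n}"
  obtain a where a: "a \<in> topspace X" using ne by blast
  have im: "?f ` topspace ?S = topspace (Pfin X)"
  proof
    show "?f ` topspace ?S \<subseteq> topspace (Pfin X)"
      by (auto simp: topspace_finite_power topspace_Pfin fin_subsets_def PiE_iff lessThan_empty_iff)
    show "topspace (Pfin X) \<subseteq> ?f ` topspace ?S"
    proof
      fix F assume "F \<in> topspace (Pfin X)"
      then have F: "finite F" "F \<subseteq> topspace X" "F \<noteq> {}"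
        unfolding topspace_Pfin fin_subsets_def by auto
      obtain x where x: "x \<in> topspace (finite_power X (card F))" "x ` {..<card F} = F"
        using finite_power_obtain[OF F(1,2)] by metis
      have "card F \<ge> 1" using F by (simp add: Suc_leI card_gt_0_iff)
      then have "(card F, x) \<in> topspace ?S" using x by simp
      moreover have "F = ?f (card F, x)" using x by simp
      ultimately show "F \<in> ?f ` topspace ?S" by (rule rev_image_eqI)
    qed
  qed
  show "topspace (Pfin X) \<noteq> {}"
    unfolding topspace_Pfin fin_subsets_def using a by (auto intro!: exI[of _ "{a}"])
  then have "topspace ?S \<noteq> {}" unfolding im[symmetric] by (rule contrapos_nn) simp
  then show "Gerlits_Nagy_space ?S"
    using GN by (intro Gerlits_Nagy_sum_topology) auto
  show "?f ` topspace ?S = topspace (Pfin X)" by (rule im)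
  show "continuous_map ?S (Pfin X) ?f"
    by (rule continuous_map_from_sum_topology)
      (simp add: continuous_map_image_Pfin lessThan_empty_iff)
qed

section \<open>Coverings of the space of finite subsets by omega-covers\<close>

lemma omega_covers_iff:
  "\<U> \<in> omega_covers X \<longleftrightarrow>
     \<U> \<subseteq> proper_opens X \<and> (\<forall>F\<in>fin_subsets (topspace X). \<exists>U\<in>\<U>. F \<subseteq> U)"
proof -
  have "topspace X \<subseteq> \<Union>\<U>" if "\<forall>F\<in>fin_subsets (topspace X). \<exists>U\<in>\<U>. F \<subseteq> U"
  proof
    fix x assume "x \<in> topspace X"
    then have "{x} \<in> fin_subsets (topspace X)" unfolding fin_subsets_def by simp
    with that show "x \<in> \<Union>\<U>" by blast
  qed
  then show ?thesis unfolding omega_covers_def open_covers_iff by auto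
qed

definition finite_parts :: "'a topology \<Rightarrow> 'a set \<Rightarrow> 'a set set" where
  "finite_parts X U = {F \<in> fin_subsets (topspace X). F \<subseteq> U}"

lemma omega_covers_eq_covering:
  "omega_covers X = covering (Pfin X) (proper_opens X) (finite_parts X)"
  unfolding covering_def topspace_Pfin finite_parts_def
  by (auto simp: omega_covers_iff subset_iff)

text \<open>Add to \<open>F\<close> a point outside the given proper open set.\<close>

lemma separated_pieces_finite_parts:
  "separated_pieces (Pfin X) (proper_opens X) (finite_parts X)"
  unfolding separated_pieces_def
proof (intro ballI)
  fix F U assume F: "F \<in> topspace (Pfin X)" and U: "U \<in> proper_opens X"
  then obtain y where y: "y \<in> topspace X" "y \<notin> U"
    unfolding proper_opens_def using openin_subset by blast
  show "\<exists>F'\<in>topspace (Pfin X). F' \<notin> finite_parts X U \<and>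
      (\<forall>U\<in>proper_opens X. F' \<in> finite_parts X U \<longrightarrow> F \<in> finite_parts X U)"
    using F y by (intro bexI[of _ "insert y F"]) (auto simp: topspace_Pfin fin_subsets_def finite_parts_def)
qed

lemma no_winning_strategy_omega_covers:
  assumes GN: "Gerlits_Nagy_space (Pfin X)" and ne: "topspace X \<noteq> {}"
  shows "\<not> winning_strategy_One (omega_covers X) (groupable (omega_covers X)) \<sigma>"
  unfolding omega_covers_eq_covering
proof (rule One_no_winning_strategy[OF _ _ _ _ separated_pieces_finite_parts])
  obtain x where "x \<in> topspace X" using ne by blast
  then have "{x} \<in> topspace (Pfin X)" unfolding topspace_Pfin fin_subsets_def by simp
  then show "topspace (Pfin X) \<noteq> {}" by blast
  show "openin (Pfin X) (finite_parts X U)" if "U \<in> proper_opens X" for U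
    using that openin_Pfin_subsets unfolding finite_parts_def proper_opens_def by blast
qed (use GN in \<open>auto simp: Gerlits_Nagy_space_def\<close>)

lemma S1_covering_groupable:
  assumes "Gerlits_Nagy_space Z" "topspace Z \<noteq> {}"
    and "\<And>c. c \<in> P \<Longrightarrow> openin Z (V c)" "separated_pieces Z P V"
  shows "S1 (covering Z P V) (groupable (covering Z P V))"
proof (rule no_winning_strategy_imp_S1)
  show "\<nexists>\<sigma>. winning_strategy_One (covering Z P V) (groupable (covering Z P V)) \<sigma>"
    using One_no_winning_strategy[of Z P V] assms unfolding Gerlits_Nagy_space_def by simp
qed

section \<open>Finite powers of a space with groupable omega-covers\<close>

text \<open>Each of the finitely many tuples from \<open>F\<close> has a box inside \<open>W\<close>. Intersecting, for a fixed point
  \<open>x\<close> of \<open>F\<close>, all the sides of these boxes at which \<open>x\<close> occurs gives a neighbourhood \<open>N x\<close>; the union of the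
  \<open>N x\<close> works, because a tuple in its power is coordinatewise close to a tuple from \<open>F\<close>.\<close>

lemma box_neighbourhood_of_finite_power:
  assumes F: "finite F" "F \<subseteq> topspace X" and W: "openin (finite_power X n) W"
    and sub: "({..<n} \<rightarrow>\<^sub>E F) \<subseteq> W"
  obtains U where "openin X U" "F \<subseteq> U" "({..<n} \<rightarrow>\<^sub>E U) \<subseteq> W"
proof -
  let ?A = "{..<n} \<rightarrow>\<^sub>E F"
  have "\<forall>a\<in>?A. \<exists>V. (\<forall>i<n. openin X (V i)) \<and> a \<in> Pi\<^sub>E {..<n} V \<and> Pi\<^sub>E {..<n} V \<subseteq> W"
  proof
    fix a assume "a \<in> ?A"
    then have "a \<in> W" using sub by (simp only: subsetD)
    from bspec[OF W[unfolded finite_power_def openin_product_topology_alt] this] obtain V where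
      "finite {i \<in> {..<n}. V i \<noteq> topspace X} \<and> (\<forall>i\<in>{..<n}. openin X (V i)) \<and>
        a \<in> Pi\<^sub>E {..<n} V \<and> Pi\<^sub>E {..<n} V \<subseteq> W" ..
    then show "\<exists>V. (\<forall>i<n. openin X (V i)) \<and> a \<in> Pi\<^sub>E {..<n} V \<and> Pi\<^sub>E {..<n} V \<subseteq> W"
      by (intro exI[of _ V]) simp
  qed
  from bchoice[OF this] obtain V
    where V: "\<forall>a\<in>?A. (\<forall>i<n. openin X (V a i)) \<and> a \<in> Pi\<^sub>E {..<n} (V a) \<and> Pi\<^sub>E {..<n} (V a) \<subseteq> W" ..
  have finA: "finite ?A" using F(1) by (intro finite_PiE) auto
  define I where "I x = {p \<in> ?A \<times> {..<n}. fst p (snd p) = x}" for x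
  have finI: "finite (I x)" for x
    unfolding I_def by (intro finite_Collect_conjI disjI1) (simp add: finA)
  define N where "N x = (\<Inter>p\<in>I x. V (fst p) (snd p)) \<inter> topspace X" for x
  have N: "openin X (N x)" for x
    unfolding N_def
  proof (intro openin_INT finI)
    fix p assume "p \<in> I x"
    then have "fst p \<in> ?A" "snd p < n"
      unfolding I_def by (simp_all only: mem_Collect_eq mem_Times_iff lessThan_iff)
    then show "openin X (V (fst p) (snd p))" using V[THEN bspec, of "fst p"] by simp
  qed
  have xN: "x \<in> N x" if "x \<in> F" for x
  proof -
    have "x \<in> V (fst p) (snd p)" if "p \<in> I x" for p
    proof -
      have "fst p \<in> ?A" "snd p < n" "fst p (snd p) = x"
        using that unfolding I_def by (simp_all only: mem_Collect_eq mem_Times_iff lessThan_iff)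
      moreover have "fst p \<in> Pi\<^sub>E {..<n} (V (fst p))" using V[THEN bspec, of "fst p"] calculation(1) by simp
      ultimately show ?thesis using PiE_mem[of "fst p" "{..<n}" "V (fst p)" "snd p"] by simp
    qed
    moreover have "x \<in> topspace X" using that F(2) by (rule rev_subsetD)
    ultimately show ?thesis unfolding N_def by (intro IntI INT_I)
  qed
  show ?thesis
  proof (rule that[of "\<Union>x\<in>F. N x"])
    show "openin X (\<Union>x\<in>F. N x)" using N by auto
    show "F \<subseteq> (\<Union>x\<in>F. N x)" using xN by auto
    show "({..<n} \<rightarrow>\<^sub>E (\<Union>x\<in>F. N x)) \<subseteq> W"
    proof
      fix u assume u: "u \<in> {..<n} \<rightarrow>\<^sub>E (\<Union>x\<in>F. N x)"
      then have "\<forall>i\<in>{..<n}. \<exists>x. x \<in> F \<and> u i \<in> N x" by (auto simp: PiE_iff)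
      from bchoice[OF this] obtain f where f: "\<forall>i\<in>{..<n}. f i \<in> F \<and> u i \<in> N (f i)" ..
      define a where "a = restrict f {..<n}"
      have a: "a \<in> ?A" unfolding a_def using f by auto
      have "u i \<in> V a i" if "i < n" for i
      proof -
        have "(a, i) \<in> I (f i)" using a that unfolding I_def a_def by auto
        moreover have "u i \<in> N (f i)" using f that by simp
        ultimately have "u i \<in> (\<Inter>p\<in>I (f i). V (fst p) (snd p))" unfolding N_def by simp
        then have "u i \<in> V (fst (a, i)) (snd (a, i))" using \<open>(a, i) \<in> I (f i)\<close> by (rule INT_D)
        then show ?thesis by simp
      qed
      then have "u \<in> Pi\<^sub>E {..<n} (V a)" using u by (auto simp: PiE_iff)
      then show "u \<in> W" by (rule subsetD[OF V[THEN bspec, OF a, THEN conjunct2, THEN conjunct2]])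
    qed
  qed
qed

text \<open>The neighbourhood found for \<open>F\<close> might be all of \<open>X\<close>; removing a point outside the finite set \<open>F\<close>
  makes it proper.\<close>

lemma omega_cover_of_power_refinement:
  assumes X: "Hausdorff_space X" "infinite (topspace X)"
    and Q: "\<And>F. F \<in> fin_subsets (topspace X) \<Longrightarrow>
        \<exists>W. openin (finite_power X n) W \<and> Q W \<and> ({..<n} \<rightarrow>\<^sub>E F) \<subseteq> W"
  shows "{U \<in> proper_opens X. \<exists>W. Q W \<and> ({..<n} \<rightarrow>\<^sub>E U) \<subseteq> W} \<in> omega_covers X"
  unfolding omega_covers_iff
proof (intro conjI ballI)
  fix F assume F: "F \<in> fin_subsets (topspace X)"
  then have F': "finite F" "F \<subseteq> topspace X" "F \<noteq> {}" unfolding fin_subsets_def by auto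
  obtain W where W: "openin (finite_power X n) W" "Q W" "({..<n} \<rightarrow>\<^sub>E F) \<subseteq> W" using Q[OF F] by metis
  obtain U where U: "openin X U" "F \<subseteq> U" "({..<n} \<rightarrow>\<^sub>E U) \<subseteq> W"
    using box_neighbourhood_of_finite_power[OF F'(1,2) W(1,3)] by metis
  obtain y where y: "y \<in> topspace X" "y \<notin> F" using X(2) F'(1) by (meson finite_subset subsetI)
  have "openin X (U - {y})" by (rule open_in_Hausdorff_delete[OF X(1) U(1)])
  then have "U - {y} \<in> proper_opens X" using F' U(2) y unfolding proper_opens_def by auto
  moreover have "({..<n} \<rightarrow>\<^sub>E U - {y}) \<subseteq> W" using U(3) PiE_mono[of "{..<n}" "\<lambda>_. U - {y}" "\<lambda>_. U"] by auto
  moreover have "F \<subseteq> U - {y}" using U y by auto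
  ultimately show "\<exists>U\<in>{U \<in> proper_opens X. \<exists>W. Q W \<and> ({..<n} \<rightarrow>\<^sub>E U) \<subseteq> W}. F \<subseteq> U"
    using W(2) by (intro bexI[of _ "U - {y}"]) auto
qed auto

lemma coordinates_in_fin_subsets:
  assumes "n \<ge> 1" "z \<in> topspace (finite_power X n)"
  shows "z ` {..<n} \<in> fin_subsets (topspace X)"
  using assms by (auto simp: fin_subsets_def topspace_finite_power PiE_iff lessThan_empty_iff)

lemma in_power_of_superset:
  assumes "z \<in> topspace (finite_power X n)" "z ` {..<n} \<subseteq> U"
  shows "z \<in> {..<n} \<rightarrow>\<^sub>E U"
  using assms by (auto simp: topspace_finite_power PiE_iff)

text \<open>The \<open>m\<close>-th \<open>\<omega>\<close>-cover is chosen so that the powers of its members are finitely covered by every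
  cover of the power up to the \<open>m\<close>-th, not just by that one. A group of the selected sets that avoids the
  first \<open>j\<close> of them can then serve stage \<open>j\<close>, wherever the grouping has placed it.\<close>

lemma Hurewicz_finite_power:
  assumes X: "Hausdorff_space X" "infinite (topspace X)" and n: "n \<ge> 1"
    and S: "S1 (omega_covers X) (groupable (omega_covers X))"
  shows "Hurewicz_space (finite_power X n)"
  unfolding Hurewicz_space_def
proof (intro allI impI)
  let ?P = "finite_power X n"
  fix \<U> assume \<U>: "\<forall>m::nat. \<U> m \<in> open_covers ?P"
  define Q where "Q m W \<longleftrightarrow> (\<forall>j\<le>m. \<exists>\<F>. finite \<F> \<and> \<F> \<subseteq> \<U> j \<and> W \<subseteq> \<Union>\<F>)" for m :: nat and W
  define \<O> where "\<O> m = {U \<in> proper_opens X. \<exists>W. Q m W \<and> ({..<n} \<rightarrow>\<^sub>E U) \<subseteq> W}" for m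
  have "\<O> m \<in> omega_covers X" for m
    unfolding \<O>_def
  proof (rule omega_cover_of_power_refinement[OF X])
    fix F assume F: "F \<in> fin_subsets (topspace X)"
    let ?A = "{..<n} \<rightarrow>\<^sub>E F"
    have finA: "finite ?A" using F unfolding fin_subsets_def by (intro finite_PiE) auto
    have Asub: "?A \<subseteq> topspace ?P"
      using F unfolding topspace_finite_power fin_subsets_def by (intro PiE_mono) auto
    have "\<exists>\<F>. finite \<F> \<and> \<F> \<subseteq> \<U> j \<and> ?A \<subseteq> \<Union>\<F>" for j
    proof -
      have "?A \<subseteq> \<Union>(\<U> j)" using \<U> Asub unfolding open_covers_def by blast
      then show ?thesis using finite_subset_Union[OF finA] by metis
    qed
    then have "\<forall>j. \<exists>\<F>. finite \<F> \<and> \<F> \<subseteq> \<U> j \<and> ?A \<subseteq> \<Union>\<F>" ..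
    from choice[OF this] obtain \<F> where "\<forall>j. finite (\<F> j) \<and> \<F> j \<subseteq> \<U> j \<and> ?A \<subseteq> \<Union>(\<F> j)" ..
    then have \<F>: "\<And>j. finite (\<F> j)" "\<And>j. \<F> j \<subseteq> \<U> j" "\<And>j. ?A \<subseteq> \<Union>(\<F> j)" by simp_all
    let ?W = "(\<Inter>j\<in>{..m}. \<Union>(\<F> j)) \<inter> topspace ?P"
    have "openin ?P U" if "U \<in> \<F> j" for U j
    proof -
      have "U \<in> \<U> j" using that \<F>(2) by auto
      then show ?thesis using \<U> unfolding open_covers_def proper_opens_def by auto
    qed
    then have "openin ?P ?W" by (intro openin_INT openin_Union) auto
    moreover have "Q m ?W" unfolding Q_def
    proof (intro allI impI)
      fix j assume "j \<le> m"
      then have "?W \<subseteq> \<Union>(\<F> j)" by auto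
      then show "\<exists>\<F>. finite \<F> \<and> \<F> \<subseteq> \<U> j \<and> ?W \<subseteq> \<Union>\<F>"
        using \<F>(1,2) by (intro exI[of _ "\<F> j"]) auto
    qed
    moreover have "?A \<subseteq> ?W" using \<F>(3) Asub by auto
    ultimately show "\<exists>W. openin ?P W \<and> Q m W \<and> ?A \<subseteq> W" by (intro exI[of _ ?W] conjI)
  qed
  then have "\<exists>U. (\<forall>m. U m \<in> \<O> m) \<and> range U \<in> groupable (omega_covers X)"
    using S[unfolded S1_def, rule_format, of \<O>] by simp
  then obtain U where "(\<forall>m. U m \<in> \<O> m) \<and> range U \<in> groupable (omega_covers X)" ..
  then have U: "\<And>m. U m \<in> \<O> m" "range U \<in> groupable (omega_covers X)" by simp_all
  obtain \<phi> :: "'a set \<Rightarrow> nat" where \<phi>: "\<And>k. finite {c \<in> range U. \<phi> c = k}"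
    and ev: "\<And>Q. \<forall>D\<in>omega_covers X. \<exists>c\<in>D. Q c \<Longrightarrow>
        \<exists>m. \<forall>k\<ge>m. \<exists>c\<in>range U. \<phi> c = k \<and> Q c"
    by (rule groupable_eventually[OF U(2)]) (rule that)
  \<comment> \<open>A number which is at least \<open>j\<close> and exceeds the group numbers of the first \<open>j\<close> selected sets.\<close>
  define k where "k j = Suc (j + (\<Sum>i<j. \<phi> (U i)))" for j
  define G where "G j = {c \<in> range U. \<phi> c = k j}" for j
  have "\<exists>\<F>. finite \<F> \<and> \<F> \<subseteq> \<U> j \<and> ({..<n} \<rightarrow>\<^sub>E c) \<subseteq> \<Union>\<F>" if "c \<in> G j" for c j
  proof -
    have c: "c \<in> range U" "\<phi> c = k j" using that unfolding G_def by simp_all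
    from c(1) obtain m where "c = U m" by (rule rangeE)
    with c(2) have m: "c = U m" "\<phi> (U m) = k j" by simp_all
    have "\<not> m < j"
    proof
      assume "m < j"
      then have "\<phi> (U m) \<le> (\<Sum>i<j. \<phi> (U i))" by (intro member_le_sum) auto
      with m(2) show False unfolding k_def by simp
    qed
    then have "j \<le> m" by simp
    moreover obtain W where "Q m W" "({..<n} \<rightarrow>\<^sub>E c) \<subseteq> W" using U(1)[of m] unfolding \<O>_def m(1) by auto
    moreover obtain \<F> where "finite \<F>" "\<F> \<subseteq> \<U> j" "W \<subseteq> \<Union>\<F>" using calculation unfolding Q_def by auto
    ultimately show ?thesis by (intro exI[of _ \<F>]) auto
  qed
  then have E_ex: "\<exists>\<F>. c \<in> G j \<longrightarrow> finite \<F> \<and> \<F> \<subseteq> \<U> j \<and> ({..<n} \<rightarrow>\<^sub>E c) \<subseteq> \<Union>\<F>" for j c by simp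
  define E where "E j c =
    (SOME \<F>. c \<in> G j \<longrightarrow> finite \<F> \<and> \<F> \<subseteq> \<U> j \<and> ({..<n} \<rightarrow>\<^sub>E c) \<subseteq> \<Union>\<F>)" for j c
  have E: "finite (E j c) \<and> E j c \<subseteq> \<U> j \<and> ({..<n} \<rightarrow>\<^sub>E c) \<subseteq> \<Union>(E j c)" if "c \<in> G j" for j c
    using someI_ex[OF E_ex[of c j], folded E_def] that by simp
  have Pne: "topspace ?P \<noteq> {}"
  proof -
    have "topspace X \<noteq> {}" using X(2) by auto
    then show ?thesis unfolding topspace_finite_power PiE_eq_empty_iff by simp
  qed
  have U0: "(SOME U. U \<in> \<U> j) \<in> \<U> j" for j
    using open_cover_nonempty[OF \<U>[rule_format] Pne] by (simp add: some_in_eq)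
  define \<F> where "\<F> j = insert (SOME U. U \<in> \<U> j) (\<Union>c\<in>G j. E j c)" for j
  show "\<exists>\<F>. (\<forall>m. \<F> m \<in> fin_subsets (\<U> m)) \<and> (\<forall>z\<in>topspace ?P. \<exists>m. \<forall>j\<ge>m. z \<in> \<Union>(\<F> j))"
  proof (intro exI[of _ \<F>] conjI allI ballI)
    fix j
    have "finite (G j)" unfolding G_def by (rule \<phi>)
    then have "finite (\<F> j)" unfolding \<F>_def using E by simp
    moreover have "\<F> j \<subseteq> \<U> j" unfolding \<F>_def using E U0 by blast
    ultimately show "\<F> j \<in> fin_subsets (\<U> j)" unfolding fin_subsets_def \<F>_def by simp
  next
    fix z assume z: "z \<in> topspace ?P"
    have "\<exists>m. \<forall>k\<ge>m. \<exists>c\<in>range U. \<phi> c = k \<and> z ` {..<n} \<subseteq> c"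
      by (rule ev) (use coordinates_in_fin_subsets[OF n z] in \<open>simp add: omega_covers_iff\<close>)
    then obtain m where m: "\<forall>k\<ge>m. \<exists>c\<in>range U. \<phi> c = k \<and> z ` {..<n} \<subseteq> c" ..
    have "z \<in> \<Union>(\<F> j)" if "j \<ge> m" for j
    proof -
      have "k j \<ge> m" using that unfolding k_def by simp
      with m have "\<exists>c\<in>range U. \<phi> c = k j \<and> z ` {..<n} \<subseteq> c" by simp
      then obtain c where "c \<in> range U" "\<phi> c = k j \<and> z ` {..<n} \<subseteq> c" ..
      then have c: "c \<in> G j" "z ` {..<n} \<subseteq> c" unfolding G_def by simp_all
      have "z \<in> {..<n} \<rightarrow>\<^sub>E c" by (rule in_power_of_superset[OF z c(2)])
      then have "z \<in> \<Union>(E j c)" using E[OF c(1)] by auto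
      then show ?thesis unfolding \<F>_def using c(1) by auto
    qed
    then show "\<exists>m. \<forall>j\<ge>m. z \<in> \<Union>(\<F> j)" by auto
  qed
qed

text \<open>Stage \<open>m\<close> of the selection on \<open>X\<close> has infinitely many covers of the power at its disposal, those with
  index \<open>prod_encode (m, i)\<close>. A finite set \<open>F\<close> has finitely many tuples, say \<open>l\<close> of them, and these are covered by
  one set from each of the first \<open>l\<close> of those covers.\<close>

lemma Rothberger_finite_power:
  assumes X: "Hausdorff_space X" "infinite (topspace X)" and n: "n \<ge> 1"
    and S: "S1 (omega_covers X) (omega_covers X)"
  shows "Rothberger_space (finite_power X n)"
  unfolding Rothberger_space_def S1_def
proof (intro allI impI)
  let ?P = "finite_power X n"
  fix \<U> assume \<U>: "\<forall>m::nat. \<U> m \<in> open_covers ?P"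
  define Q where "Q m W \<longleftrightarrow>
    (\<exists>(l::nat) w. (\<forall>i<l. w i \<in> \<U> (prod_encode (m, i))) \<and> W \<subseteq> (\<Union>i<l. w i))" for m W
  define \<O> where "\<O> m = {U \<in> proper_opens X. \<exists>W. Q m W \<and> ({..<n} \<rightarrow>\<^sub>E U) \<subseteq> W}" for m
  have "\<O> m \<in> omega_covers X" for m
    unfolding \<O>_def
  proof (rule omega_cover_of_power_refinement[OF X])
    fix F assume F: "F \<in> fin_subsets (topspace X)"
    let ?A = "{..<n} \<rightarrow>\<^sub>E F"
    have finA: "finite ?A" using F unfolding fin_subsets_def by (intro finite_PiE) auto
    have Asub: "?A \<subseteq> topspace ?P"
      using F unfolding topspace_finite_power fin_subsets_def by (intro PiE_mono) auto
    obtain h where h: "bij_betw h {0..<card ?A} ?A" using ex_bij_betw_nat_finite[OF finA] ..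
    have "\<forall>i\<in>{..<card ?A}. \<exists>U. U \<in> \<U> (prod_encode (m, i)) \<and> h i \<in> U"
    proof
      fix i assume "i \<in> {..<card ?A}"
      then have "h i \<in> h ` {0..<card ?A}" by simp
      then have "h i \<in> topspace ?P" using h Asub unfolding bij_betw_def by (simp only: subsetD)
      moreover have "\<Union>(\<U> (prod_encode (m, i))) = topspace ?P" using \<U> unfolding open_covers_def by simp
      ultimately show "\<exists>U. U \<in> \<U> (prod_encode (m, i)) \<and> h i \<in> U" by blast
    qed
    from bchoice[OF this] obtain w
      where w: "\<forall>i\<in>{..<card ?A}. w i \<in> \<U> (prod_encode (m, i)) \<and> h i \<in> w i" ..
    let ?W = "\<Union>i<card ?A. w i"
    have "openin ?P (w i)" if "i < card ?A" for i
    proof -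
      have "\<U> (prod_encode (m, i)) \<subseteq> proper_opens ?P" using \<U> unfolding open_covers_def by simp
      then show ?thesis using w that unfolding proper_opens_def by auto
    qed
    then have "openin ?P ?W" by (intro openin_Union) auto
    moreover have "Q m ?W" unfolding Q_def using w by (intro exI[of _ "card ?A"] exI[of _ w]) auto
    moreover have "?A \<subseteq> ?W"
    proof
      fix a assume "a \<in> ?A"
      then have "a \<in> h ` {0..<card ?A}" using h unfolding bij_betw_def by simp
      then obtain i where "i < card ?A" "a = h i" by auto
      then show "a \<in> ?W" using w by auto
    qed
    ultimately show "\<exists>W. openin ?P W \<and> Q m W \<and> ?A \<subseteq> W" by (intro exI[of _ ?W] conjI)
  qed
  then have "\<exists>U. (\<forall>m. U m \<in> \<O> m) \<and> range U \<in> omega_covers X"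
    using S[unfolded S1_def, rule_format, of \<O>] by simp
  then obtain U where "(\<forall>m. U m \<in> \<O> m) \<and> range U \<in> omega_covers X" ..
  then have U: "\<And>m. U m \<in> \<O> m" "range U \<in> omega_covers X" by simp_all
  have "\<forall>m. \<exists>l w. (\<forall>i<l. w i \<in> \<U> (prod_encode (m, i))) \<and> ({..<n} \<rightarrow>\<^sub>E U m) \<subseteq> (\<Union>i<l. w i)"
  proof
    fix m
    obtain W where W: "Q m W" "({..<n} \<rightarrow>\<^sub>E U m) \<subseteq> W" using U(1)[of m] unfolding \<O>_def by auto
    from W(1) obtain l :: nat where "\<exists>w. (\<forall>i<l. w i \<in> \<U> (prod_encode (m, i))) \<and> W \<subseteq> (\<Union>i<l. w i)"
      unfolding Q_def ..
    then obtain w where "(\<forall>i<l. w i \<in> \<U> (prod_encode (m, i))) \<and> W \<subseteq> (\<Union>i<l. w i)" ..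
    then show "\<exists>l w. (\<forall>i<l. w i \<in> \<U> (prod_encode (m, i))) \<and> ({..<n} \<rightarrow>\<^sub>E U m) \<subseteq> (\<Union>i<l. w i)"
      using W(2) by (intro exI[of _ l] exI[of _ w] conjI) (auto dest: subsetD)
  qed
  from choice[OF this] obtain l where "\<forall>m. \<exists>w. (\<forall>i<l m. w i \<in> \<U> (prod_encode (m, i))) \<and>
      ({..<n} \<rightarrow>\<^sub>E U m) \<subseteq> (\<Union>i<l m. w i)" ..
  from choice[OF this] obtain w where w: "\<forall>m. (\<forall>i<l m. w m i \<in> \<U> (prod_encode (m, i))) \<and>
      ({..<n} \<rightarrow>\<^sub>E U m) \<subseteq> (\<Union>i<l m. w m i)" ..
  have Pne: "topspace ?P \<noteq> {}"
  proof -
    have "topspace X \<noteq> {}" using X(2) by auto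
    then show ?thesis unfolding topspace_finite_power PiE_eq_empty_iff by simp
  qed
  have U0: "(SOME U. U \<in> \<U> j) \<in> \<U> j" for j
    using open_cover_nonempty[OF \<U>[rule_format] Pne] by (simp add: some_in_eq)
  define c where "c j = (if snd (prod_decode j) < l (fst (prod_decode j))
    then w (fst (prod_decode j)) (snd (prod_decode j)) else (SOME U. U \<in> \<U> j))" for j
  have c: "c j \<in> \<U> j" for j
  proof (cases "snd (prod_decode j) < l (fst (prod_decode j))")
    case True
    then show ?thesis
      using w[rule_format, THEN conjunct1, rule_format, OF True] unfolding c_def by simp
  next
    case False
    then show ?thesis using U0 unfolding c_def by simp
  qed
  have "\<exists>j. z \<in> c j" if z: "z \<in> topspace ?P" for z
  proof -
    obtain m where "z ` {..<n} \<subseteq> U m"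
      using U(2) coordinates_in_fin_subsets[OF n z] unfolding omega_covers_iff by auto
    then have "z \<in> {..<n} \<rightarrow>\<^sub>E U m" by (rule in_power_of_superset[OF z])
    then have "z \<in> (\<Union>i<l m. w m i)"
      by (rule subsetD[OF w[THEN spec, of m, THEN conjunct2]])
    then obtain i where "i < l m" "z \<in> w m i" by auto
    then have "z \<in> c (prod_encode (m, i))" unfolding c_def by simp
    then show ?thesis ..
  qed
  then have "topspace ?P \<subseteq> \<Union>(range c)" by auto
  moreover have "range c \<subseteq> proper_opens ?P" using c \<U> unfolding open_covers_def by auto
  ultimately have "range c \<in> open_covers ?P" unfolding open_covers_iff by (intro conjI)
  then show "\<exists>x. (\<forall>m. x m \<in> \<U> m) \<and> range x \<in> open_covers ?P" using c by (intro exI[of _ c]) simp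
qed

section \<open>From the space of finite subsets back to the space\<close>

lemma groupable_transfer:
  assumes inj: "inj_on b P" and C: "C \<subseteq> P" "b ` C \<in> groupable \<B>"
    and tr: "\<And>C. C \<subseteq> P \<Longrightarrow> b ` C \<in> \<B> \<Longrightarrow> C \<in> \<A>"
  shows "C \<in> groupable \<A>"
proof -
  obtain \<phi> :: "_ \<Rightarrow> nat" where \<phi>: "\<And>n. finite {c \<in> b ` C. \<phi> c = n}"
    "\<And>J. infinite J \<Longrightarrow> (\<Union>n\<in>J. {c \<in> b ` C. \<phi> c = n}) \<in> \<B>" and bC: "b ` C \<in> \<B>"
    using C(2) unfolding groupable_def by blast
  have im: "b ` {c \<in> C. (\<phi> \<circ> b) c = n} = {c \<in> b ` C. \<phi> c = n}" for n by auto
  have "finite {c \<in> C. (\<phi> \<circ> b) c = n}" for n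
  proof (rule finite_imageD)
    show "finite (b ` {c \<in> C. (\<phi> \<circ> b) c = n})" unfolding im by (rule \<phi>(1))
    show "inj_on b {c \<in> C. (\<phi> \<circ> b) c = n}" by (rule inj_on_subset[OF inj]) (use C(1) in auto)
  qed
  moreover have "(\<Union>n\<in>J. {c \<in> C. (\<phi> \<circ> b) c = n}) \<in> \<A>" if "infinite J" for J
  proof (rule tr)
    show "(\<Union>n\<in>J. {c \<in> C. (\<phi> \<circ> b) c = n}) \<subseteq> P" using C(1) by auto
    show "b ` (\<Union>n\<in>J. {c \<in> C. (\<phi> \<circ> b) c = n}) \<in> \<B>"
      unfolding image_UN im by (rule \<phi>(2)[OF that])
  qed
  ultimately show ?thesis by (intro groupableI[OF tr[OF C(1) bC], of "\<phi> \<circ> b"])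
qed

lemma S1_transfer:
  assumes S: "S1 \<B> \<B>'"
    and fwd: "\<And>C. C \<in> \<A> \<Longrightarrow> C \<subseteq> P \<and> b ` C \<in> \<B>"
    and bwd: "\<And>C. C \<subseteq> P \<Longrightarrow> b ` C \<in> \<B>' \<Longrightarrow> C \<in> \<A>'"
  shows "S1 \<A> \<A>'"
  unfolding S1_def
proof (intro allI impI)
  fix U :: "nat \<Rightarrow> _ set" assume U: "\<forall>n. U n \<in> \<A>"
  then have "\<forall>n. b ` U n \<in> \<B>" using fwd by simp
  then obtain y where y: "\<forall>n. y n \<in> b ` U n" "range y \<in> \<B>'"
    using S[unfolded S1_def, rule_format, of "\<lambda>n. b ` U n"] by auto
  then have "\<forall>n. \<exists>c. c \<in> U n \<and> y n = b c" by auto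
  from choice[OF this] obtain x where x: "\<forall>n. x n \<in> U n \<and> y n = b (x n)" ..
  have "range y = b ` range x" using x by auto
  moreover have "range x \<subseteq> P" using x U fwd by blast
  ultimately have "range x \<in> \<A>'" using bwd y(2) by simp
  then show "\<exists>x. (\<forall>n. x n \<in> U n) \<and> range x \<in> \<A>'" using x by (intro exI[of _ x]) simp
qed

lemma omega_cover_Pfin_finite_parts:
  assumes C: "C \<subseteq> proper_opens X"
  shows "finite_parts X ` C \<in> omega_covers (Pfin X) \<longleftrightarrow> C \<in> omega_covers X"
proof
  assume "finite_parts X ` C \<in> omega_covers (Pfin X)"
  then have *: "\<And>\<F>. \<F> \<in> fin_subsets (fin_subsets (topspace X)) \<Longrightarrow> \<exists>U\<in>C. \<F> \<subseteq> finite_parts X U"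
    unfolding omega_covers_iff topspace_Pfin by auto
  have "\<exists>U\<in>C. F \<subseteq> U" if "F \<in> fin_subsets (topspace X)" for F
  proof -
    have "{F} \<in> fin_subsets (fin_subsets (topspace X))" using that unfolding fin_subsets_def by simp
    from *[OF this] show ?thesis unfolding finite_parts_def by auto
  qed
  then show "C \<in> omega_covers X" using C unfolding omega_covers_iff by simp
next
  assume om: "C \<in> omega_covers X"
  show "finite_parts X ` C \<in> omega_covers (Pfin X)"
    unfolding omega_covers_iff topspace_Pfin
  proof (intro conjI ballI)
    show "finite_parts X ` C \<subseteq> proper_opens (Pfin X)"
    proof
      fix V assume "V \<in> finite_parts X ` C"
      then obtain U where U: "U \<in> C" "V = finite_parts X U" by auto
      then have "openin X U" "U \<noteq> {}" "U \<noteq> topspace X" using C unfolding proper_opens_def by auto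
      moreover from this have "U \<subseteq> topspace X" by (simp add: openin_subset)
      ultimately obtain x y where xy: "x \<in> U" "x \<in> topspace X" "y \<in> topspace X" "y \<notin> U" by blast
      have "{x} \<in> V" "{y} \<in> fin_subsets (topspace X)" "{y} \<notin> V"
        using xy unfolding U(2) finite_parts_def fin_subsets_def by auto
      moreover have "openin (Pfin X) V"
        unfolding U(2) finite_parts_def by (rule openin_Pfin_subsets) fact
      ultimately show "V \<in> proper_opens (Pfin X)" unfolding proper_opens_def topspace_Pfin by auto
    qed
    fix \<F> assume \<F>: "\<F> \<in> fin_subsets (fin_subsets (topspace X))"
    then have "\<F> \<noteq> {}" "finite \<F>" and F: "\<forall>F\<in>\<F>. F \<noteq> {} \<and> finite F \<and> F \<subseteq> topspace X"
      unfolding fin_subsets_def by auto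
    then have "\<Union>\<F> \<noteq> {}" by blast
    then have "\<Union>\<F> \<in> fin_subsets (topspace X)"
      using F \<open>finite \<F>\<close> unfolding fin_subsets_def by blast
    then obtain U where "U \<in> C" "\<Union>\<F> \<subseteq> U" using om unfolding omega_covers_iff by auto
    moreover have "\<F> \<subseteq> finite_parts X U"
      using F \<open>\<Union>\<F> \<subseteq> U\<close> unfolding fin_subsets_def finite_parts_def by auto
    ultimately show "\<exists>V\<in>finite_parts X ` C. \<F> \<subseteq> V" by (intro bexI[of _ "finite_parts X U"] imageI)
  qed
qed

lemma S1_omega_groupable_of_Pfin:
  assumes "S1 (omega_covers (Pfin X)) (groupable (omega_covers (Pfin X)))"
  shows "S1 (omega_covers X) (groupable (omega_covers X))"
proof (rule S1_transfer[OF assms])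
  show "C \<subseteq> proper_opens X \<and> finite_parts X ` C \<in> omega_covers (Pfin X)" if "C \<in> omega_covers X" for C
    using that omega_cover_Pfin_finite_parts[of C X] unfolding omega_covers_iff[of C X] by auto
  have "inj_on (finite_parts X) (proper_opens X)"
  proof (rule inj_on_inverseI[of _ Union])
    fix U assume "U \<in> proper_opens X"
    then have "U \<subseteq> topspace X" unfolding proper_opens_def by (auto dest: openin_subset)
    then have "\<exists>F. F \<in> fin_subsets (topspace X) \<and> F \<subseteq> U \<and> x \<in> F" if "x \<in> U" for x
      using that by (intro exI[of _ "{x}"]) (auto simp: fin_subsets_def)
    then show "\<Union>(finite_parts X U) = U" unfolding finite_parts_def by auto
  qed
  then show "C \<in> groupable (omega_covers X)"
    if "C \<subseteq> proper_opens X" "finite_parts X ` C \<in> groupable (omega_covers (Pfin X))" for C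
    by (rule groupable_transfer[OF _ that]) (simp add: omega_cover_Pfin_finite_parts)
qed

section \<open>Groupable omega-covers of the space of finite subsets\<close>

text \<open>A finite family of finite subsets of \<open>X\<close> is coded by a tuple \<open>x\<close> that lists its union, together
  with a finite family \<open>p\<close> of sets of positions: the family consists of the images \<open>x ` A\<close> with \<open>A\<close> in
  \<open>p\<close>. There are only countably many \<open>p\<close>, and each image depends continuously on \<open>x\<close>.\<close>

lemma S1_omega_groupable_Pfin:
  assumes GN: "\<And>n. n \<ge> 1 \<Longrightarrow> Gerlits_Nagy_space (finite_power X n)" and ne: "topspace X \<noteq> {}"
  shows "S1 (omega_covers (Pfin X)) (groupable (omega_covers (Pfin X)))"
proof -
  define I :: "(nat \<times> nat set set) set"
    where "I = (SIGMA n:{1..}. {p. p \<subseteq> Pow {..<n} - {{}} \<and> p \<noteq> {}})"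
  define Z where "Z = sum_topology (\<lambda>i. finite_power X (fst i)) I"
  define t where "t = (\<lambda>z::(nat \<times> nat set set) \<times> (nat \<Rightarrow> 'a). (\<lambda>A. snd z ` A) ` snd (fst z))"
  define V where "V W = {z \<in> topspace Z. t z \<subseteq> W}" for W
  let ?T = "fin_subsets (fin_subsets (topspace X))"
  have finI: "finite {p. p \<subseteq> Pow {..<n} - {{}} \<and> p \<noteq> {}}" for n :: nat
    by (rule finite_subset[of _ "Pow (Pow {..<n})"]) auto
  have tT: "t z \<in> ?T" if "z \<in> topspace Z" for z
  proof -
    obtain n p x where z: "z = ((n, p), x)" by (metis prod.exhaust)
    have p: "p \<subseteq> Pow {..<n} - {{}}" "p \<noteq> {}" and x: "x \<in> topspace (finite_power X n)"
      using that unfolding Z_def z I_def by auto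
    have "x ` A \<in> fin_subsets (topspace X)" if "A \<in> p" for A
    proof -
      have "A \<subseteq> {..<n}" "A \<noteq> {}" using p(1) that by auto
      then show ?thesis using x finite_subset[of A "{..<n}"]
        unfolding topspace_finite_power fin_subsets_def by (auto simp: PiE_iff)
    qed
    moreover have "finite p" using p(1) by (rule finite_subset) simp
    ultimately show ?thesis using p(2) unfolding t_def z fin_subsets_def[of "fin_subsets _"] by auto
  qed
  have realise: "\<exists>z\<in>topspace Z. t z = \<F>" if "\<F> \<in> ?T" for \<F>
  proof -
    have \<F>: "finite \<F>" "\<F> \<noteq> {}" "\<And>F. F \<in> \<F> \<Longrightarrow> finite F \<and> F \<noteq> {} \<and> F \<subseteq> topspace X"
      using that unfolding fin_subsets_def by auto
    let ?n = "card (\<Union>\<F>)"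
    have fin: "finite (\<Union>\<F>)" using \<F> by auto
    have sub: "\<Union>\<F> \<subseteq> topspace X" using \<F>(3) by auto
    obtain x where x: "x \<in> topspace (finite_power X ?n)" "x ` {..<?n} = \<Union>\<F>"
      by (rule finite_power_obtain[OF fin sub]) (rule that)
    define a where "a F = {j \<in> {..<?n}. x j \<in> F}" for F
    have a: "x ` a F = F" if "F \<in> \<F>" for F
    proof -
      have "F \<subseteq> x ` {..<?n}" using that x(2) by auto
      then show ?thesis unfolding a_def by auto
    qed
    have "?n \<noteq> 0" using fin \<F>(2,3) by auto
    moreover have "a F \<noteq> {}" if "F \<in> \<F>" for F using a[OF that] \<F>(3)[OF that] by auto
    ultimately have "(?n, a ` \<F>) \<in> I" using \<F>(2) unfolding I_def a_def by auto
    then have "((?n, a ` \<F>), x) \<in> topspace Z" using x(1) unfolding Z_def by simp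
    moreover have "t ((?n, a ` \<F>), x) = \<F>" using a unfolding t_def by (simp add: image_image)
    ultimately show ?thesis by (rule bexI[rotated])
  qed
  have eq: "omega_covers (Pfin X) = covering Z (proper_opens (Pfin X)) V"
  proof -
    have "(\<forall>F\<in>?T. \<exists>U\<in>\<U>. F \<subseteq> U) \<longleftrightarrow> topspace Z \<subseteq> (\<Union>U\<in>\<U>. V U)" for \<U>
    proof
      assume *: "\<forall>F\<in>?T. \<exists>U\<in>\<U>. F \<subseteq> U"
      show "topspace Z \<subseteq> (\<Union>U\<in>\<U>. V U)" using *[THEN bspec, OF tT] unfolding V_def by auto
    next
      assume *: "topspace Z \<subseteq> (\<Union>U\<in>\<U>. V U)"
      show "\<forall>F\<in>?T. \<exists>U\<in>\<U>. F \<subseteq> U"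
      proof
        fix F assume "F \<in> ?T"
        from realise[OF this] obtain z where z: "z \<in> topspace Z" "t z = F" ..
        then have "z \<in> (\<Union>U\<in>\<U>. V U)" using * by (simp only: subsetD)
        then show "\<exists>U\<in>\<U>. F \<subseteq> U" using z(2) unfolding V_def by auto
      qed
    qed
    then show ?thesis
      unfolding covering_def by (intro set_eqI) (simp only: omega_covers_iff topspace_Pfin mem_Collect_eq)
  qed
  obtain x0 where x0: "x0 \<in> topspace X" using ne by blast
  have Zne: "topspace Z \<noteq> {}"
  proof -
    have "{{x0}} \<in> ?T" using x0 unfolding fin_subsets_def by simp
    from realise[OF this] show ?thesis by blast
  qed
  show ?thesis
    unfolding eq
  proof (rule S1_covering_groupable[OF _ Zne])
    show "Gerlits_Nagy_space Z"
      unfolding Z_def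
    proof (rule Gerlits_Nagy_sum_topology)
      show "countable I"
        unfolding I_def by (rule countable_SIGMA[OF countableI_type countable_finite[OF finI]])
      show "topspace (sum_topology (\<lambda>i. finite_power X (fst i)) I) \<noteq> {}"
        using Zne unfolding Z_def .
      show "Gerlits_Nagy_space (finite_power X (fst i))" if "i \<in> I" for i
        using that GN unfolding I_def by auto
    qed
  next
    fix W assume "W \<in> proper_opens (Pfin X)"
    then have W: "openin (Pfin X) W" unfolding proper_opens_def by simp
    have "openin (finite_power X n) {x. ((n, p), x) \<in> V W}" if "(n, p) \<in> I" for n p
    proof -
      have p: "p \<subseteq> Pow {..<n} - {{}}" using that unfolding I_def by simp
      then have "finite p" by (rule finite_subset) simp
      have "{x. ((n, p), x) \<in> V W} =
          (\<Inter>A\<in>p. {x \<in> topspace (finite_power X n). x ` A \<in> W}) \<inter> topspace (finite_power X n)"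
        using that unfolding V_def t_def Z_def by auto
      also have "openin (finite_power X n) \<dots>"
      proof (intro openin_INT \<open>finite p\<close>)
        fix A assume "A \<in> p"
        then have "A \<subseteq> {..<n}" "A \<noteq> {}" using p by auto
        then show "openin (finite_power X n) {x \<in> topspace (finite_power X n). x ` A \<in> W}"
          by (intro openin_continuous_map_preimage[OF _ W] continuous_map_image_Pfin)
      qed
      finally show ?thesis .
    qed
    then show "openin Z (V W)" unfolding Z_def openin_sum_topology
      by (auto simp: V_def Z_def)
  next
    show "separated_pieces Z (proper_opens (Pfin X)) V"
      unfolding separated_pieces_def
    proof (intro ballI)
      fix z W assume z: "z \<in> topspace Z" and W: "W \<in> proper_opens (Pfin X)"
      then have "W \<subseteq> fin_subsets (topspace X)" "W \<noteq> fin_subsets (topspace X)"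
        unfolding proper_opens_def topspace_Pfin[symmetric] by (auto dest: openin_subset)
      then obtain F where F: "F \<in> fin_subsets (topspace X)" "F \<notin> W" by auto
      have "insert F (t z) \<in> ?T" using tT[OF z] F(1) unfolding fin_subsets_def[of "fin_subsets _"] by auto
      from realise[OF this] obtain z' where z': "z' \<in> topspace Z" "t z' = insert F (t z)" ..
      then show "\<exists>z'\<in>topspace Z. z' \<notin> V W \<and> (\<forall>d\<in>proper_opens (Pfin X). z' \<in> V d \<longrightarrow> z \<in> V d)"
        using F(2) z unfolding V_def by (intro bexI[of _ z']) auto
    qed
  qed
qed

section \<open>Clustering at the zero function\<close>

lemma continuous_map_Cp_evaluation:
  assumes "x \<in> topspace X"
  shows "continuous_map (Cp X) euclideanreal (\<lambda>f. f x)"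
  unfolding Cp_def
  by (intro continuous_map_from_subtopology continuous_map_product_projection assms)

lemma Cp_zero_neighbourhood:
  assumes W: "openin (Cp X) W" "Cp_zero X \<in> W"
  obtains F e where "finite F" "F \<subseteq> topspace X" "e > 0"
    "{f \<in> topspace (Cp X). \<forall>x\<in>F. \<bar>f x\<bar> < e} \<subseteq> W"
proof -
  obtain T where T: "openin (product_topology (\<lambda>_. euclideanreal) (topspace X)) T"
      "W = T \<inter> {f. continuous_map X euclideanreal f}"
    using W(1) unfolding Cp_def openin_subtopology by auto
  then have "Cp_zero X \<in> T" using W(2) by simp
  then obtain U where U: "finite {x \<in> topspace X. U x \<noteq> (UNIV :: real set)}"
      "\<forall>x\<in>topspace X. open (U x)" "Cp_zero X \<in> Pi\<^sub>E (topspace X) U" "Pi\<^sub>E (topspace X) U \<subseteq> T"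
    using T(1)[unfolded openin_product_topology_alt, THEN bspec, of "Cp_zero X"] by auto
  let ?F = "{x \<in> topspace X. U x \<noteq> UNIV}"
  have "\<forall>x\<in>?F. \<exists>e>0. \<forall>r. \<bar>r\<bar> < e \<longrightarrow> r \<in> U x"
  proof
    fix x assume x: "x \<in> ?F"
    then have "Cp_zero X x \<in> U x" using PiE_mem[OF U(3)] by simp
    then have "0 \<in> U x" using x unfolding Cp_zero_def by simp
    moreover have "open (U x)" using U(2) x by simp
    ultimately obtain e where "e > 0" "\<forall>r. dist r 0 < e \<longrightarrow> r \<in> U x"
      unfolding open_dist by auto
    then show "\<exists>e>0. \<forall>r. \<bar>r\<bar> < e \<longrightarrow> r \<in> U x" by (intro exI[of _ e]) simp
  qed
  from bchoice[OF this] obtain e where e: "\<forall>x\<in>?F. 0 < e x \<and> (\<forall>r. \<bar>r\<bar> < e x \<longrightarrow> r \<in> U x)" ..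
  let ?e = "Min (insert 1 (e ` ?F))"
  show ?thesis
  proof (rule that[of ?F ?e])
    show "finite ?F" by (rule U(1))
    show "0 < ?e" using U(1) e by simp
    show "{f \<in> topspace (Cp X). \<forall>x\<in>?F. \<bar>f x\<bar> < ?e} \<subseteq> W"
    proof
      fix f assume f: "f \<in> {f \<in> topspace (Cp X). \<forall>x\<in>?F. \<bar>f x\<bar> < ?e}"
      then have fC: "f \<in> extensional (topspace X)" "continuous_map X euclideanreal f"
        unfolding topspace_Cp by auto
      have "f x \<in> U x" if "x \<in> topspace X" for x
      proof (cases "U x = UNIV")
        case False
        then have x: "x \<in> ?F" using that by simp
        then have "?e \<le> e x" using U(1) by (intro Min_le) auto
        moreover have "\<bar>f x\<bar> < ?e" using f x by simp
        ultimately have "\<bar>f x\<bar> < e x" by linarith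
        then show ?thesis using e x by simp
      qed simp
      then have "f \<in> Pi\<^sub>E (topspace X) U" using fC(1) by (simp add: PiE_iff)
      then show "f \<in> W" using U(4) T(2) fC(2) by auto
    qed
  qed auto
qed

lemma clusters_at_Cp_zero_iff:
  "A \<in> clusters_at (Cp X) (Cp_zero X) \<longleftrightarrow> A \<subseteq> topspace (Cp X) - {Cp_zero X} \<and>
     (\<forall>F e. finite F \<longrightarrow> F \<subseteq> topspace X \<longrightarrow> e > 0 \<longrightarrow> (\<exists>f\<in>A. \<forall>x\<in>F. \<bar>f x\<bar> < e))"
proof (cases "A \<subseteq> topspace (Cp X) - {Cp_zero X}")
  case True
  have "Cp_zero X \<in> Cp X closure_of A \<longleftrightarrow>
     (\<forall>F e. finite F \<longrightarrow> F \<subseteq> topspace X \<longrightarrow> e > 0 \<longrightarrow> (\<exists>f\<in>A. \<forall>x\<in>F. \<bar>f x\<bar> < e))" (is "_ \<longleftrightarrow> ?R")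
  proof
    assume cl: "Cp_zero X \<in> Cp X closure_of A"
    show ?R
    proof (intro allI impI)
      fix F and e :: real assume F: "finite F" "F \<subseteq> topspace X" "e > 0"
      let ?W = "(\<Inter>x\<in>F. {f \<in> topspace (Cp X). f x \<in> {-e<..<e}}) \<inter> topspace (Cp X)"
      have "openin (Cp X) ?W"
      proof (intro openin_INT F(1))
        fix x assume "x \<in> F"
        then show "openin (Cp X) {f \<in> topspace (Cp X). f x \<in> {-e<..<e}}"
          using F(2) by (intro openin_continuous_map_preimage[OF continuous_map_Cp_evaluation]) auto
      qed
      moreover have "Cp_zero X x = 0" if "x \<in> F" for x
        using that F(2) unfolding Cp_zero_def by auto
      then have "Cp_zero X \<in> ?W" using F Cp_zero_in_Cp by auto
      ultimately have "\<exists>f. f \<in> A \<and> f \<in> ?W"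
        using cl[unfolded in_closure_of, THEN conjunct2, THEN spec, of ?W] by (simp only: simp_thms)
      then obtain f where "f \<in> A \<and> f \<in> ?W" ..
      then show "\<exists>f\<in>A. \<forall>x\<in>F. \<bar>f x\<bar> < e" by (intro bexI[of _ f]) (auto simp: abs_less_iff)
    qed
  next
    assume R: ?R
    show "Cp_zero X \<in> Cp X closure_of A"
      unfolding in_closure_of
    proof (intro conjI allI impI)
      fix W assume W: "Cp_zero X \<in> W \<and> openin (Cp X) W"
      obtain F e where Fe: "finite F" "F \<subseteq> topspace X" "e > 0"
          "{f \<in> topspace (Cp X). \<forall>x\<in>F. \<bar>f x\<bar> < e} \<subseteq> W"
        by (rule Cp_zero_neighbourhood[OF W[THEN conjunct2] W[THEN conjunct1]])
      from R[rule_format, OF Fe(1-3)] obtain f where f: "f \<in> A" "\<forall>x\<in>F. \<bar>f x\<bar> < e" ..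
      then show "\<exists>f. f \<in> A \<and> f \<in> W" using True Fe(4) by (intro exI[of _ f]) auto
    qed (rule Cp_zero_in_Cp)
  qed
  with True show ?thesis unfolding clusters_at_def by auto
next
  case False
  then show ?thesis unfolding clusters_at_def by auto
qed

text \<open>The test attached to a tuple \<open>x\<close> and a number \<open>k\<close> asks for absolute values below \<open>1 / (k + 1)\<close> at all
  the coordinates of \<open>x\<close>. For a continuous \<open>f\<close> this is an open condition on \<open>x\<close>.\<close>

lemma S1_clusters_groupable_Cp_zero:
  assumes GN: "\<And>n. n \<ge> 1 \<Longrightarrow> Gerlits_Nagy_space (finite_power X n)" and ne: "topspace X \<noteq> {}"
  shows "S1 (clusters_at (Cp X) (Cp_zero X)) (groupable (clusters_at (Cp X) (Cp_zero X)))"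
proof -
  define I :: "(nat \<times> nat) set" where "I = {1..} \<times> UNIV"
  define Z where "Z = sum_topology (\<lambda>i. finite_power X (fst i)) I"
  define V where "V f = {((n, k), x). ((n, k), x) \<in> topspace Z \<and>
      (\<forall>j<n. \<bar>f (x j)\<bar> < inverse (real (Suc k)))}" for f
  have Z: "((n, k), x) \<in> topspace Z \<longleftrightarrow> n \<ge> 1 \<and> x \<in> topspace (finite_power X n)" for n k x
    unfolding Z_def I_def by auto
  obtain a where a: "a \<in> topspace X" using ne by blast
  have eq: "clusters_at (Cp X) (Cp_zero X) = covering Z (topspace (Cp X) - {Cp_zero X}) V"
  proof -
    have "(\<forall>F e. finite F \<longrightarrow> F \<subseteq> topspace X \<longrightarrow> e > 0 \<longrightarrow> (\<exists>f\<in>A. \<forall>x\<in>F. \<bar>f x\<bar> < e)) \<longleftrightarrow>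
        topspace Z \<subseteq> (\<Union>f\<in>A. V f)" for A
    proof
      assume *: "\<forall>F e. finite F \<longrightarrow> F \<subseteq> topspace X \<longrightarrow> e > 0 \<longrightarrow> (\<exists>f\<in>A. \<forall>x\<in>F. \<bar>f x\<bar> < e)"
      show "topspace Z \<subseteq> (\<Union>f\<in>A. V f)"
      proof
        fix z assume z: "z \<in> topspace Z"
        obtain n k x where nkx: "z = ((n, k), x)" by (metis prod.exhaust)
        then have nx: "n \<ge> 1" "x \<in> topspace (finite_power X n)" using z Z by auto
        have "finite (x ` {..<n})" "x ` {..<n} \<subseteq> topspace X"
          using coordinates_in_fin_subsets[OF nx] unfolding fin_subsets_def by auto
        moreover have "inverse (real (Suc k)) > 0" by simp
        ultimately obtain f where "f \<in> A" "\<forall>y\<in>x ` {..<n}. \<bar>f y\<bar> < inverse (real (Suc k))"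
          using *[rule_format, of "x ` {..<n}" "inverse (real (Suc k))"] by auto
        then show "z \<in> (\<Union>f\<in>A. V f)" using z unfolding V_def nkx by auto
      qed
    next
      assume *: "topspace Z \<subseteq> (\<Union>f\<in>A. V f)"
      show "\<forall>F e. finite F \<longrightarrow> F \<subseteq> topspace X \<longrightarrow> e > 0 \<longrightarrow> (\<exists>f\<in>A. \<forall>x\<in>F. \<bar>f x\<bar> < e)"
      proof (intro allI impI)
        fix F and e :: real assume F: "finite F" "F \<subseteq> topspace X" "e > 0"
        let ?G = "insert a F"
        obtain x where x: "x \<in> topspace (finite_power X (card ?G))" "x ` {..<card ?G} = ?G"
          by (rule finite_power_obtain[of ?G X]) (use F a in auto)
        obtain k where k: "inverse (real (Suc k)) < e" using reals_Archimedean[OF F(3)] ..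
        have "card ?G > 0" using F(1) by (simp only: card_gt_0_iff) simp
        then have "card ?G \<ge> 1" by simp
        then have "((card ?G, k), x) \<in> topspace Z" using x(1) Z by simp
        then have "((card ?G, k), x) \<in> (\<Union>f\<in>A. V f)" using * by (simp only: subsetD)
        then obtain f where f: "f \<in> A" "\<forall>j<card ?G. \<bar>f (x j)\<bar> < inverse (real (Suc k))"
          unfolding V_def by auto
        have "\<bar>f y\<bar> < e" if "y \<in> F" for y
        proof -
          have "y \<in> x ` {..<card ?G}" using that x(2) by simp
          then obtain j where "j < card ?G" "y = x j" by auto
          then have "\<bar>f y\<bar> < inverse (real (Suc k))" using f(2) by simp
          with k show ?thesis by linarith
        qed
        with f(1) show "\<exists>f\<in>A. \<forall>x\<in>F. \<bar>f x\<bar> < e" by (intro bexI[of _ f]) auto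
      qed
    qed
    then show ?thesis
      unfolding covering_def by (intro set_eqI) (simp only: clusters_at_Cp_zero_iff mem_Collect_eq)
  qed
  have Zne: "topspace Z \<noteq> {}"
  proof -
    have "((1, 0), \<lambda>j\<in>{..<1}. a) \<in> topspace Z" using a unfolding Z topspace_finite_power by simp
    then show ?thesis by blast
  qed
  show ?thesis
    unfolding eq
  proof (rule S1_covering_groupable[OF _ Zne])
    show "Gerlits_Nagy_space Z"
      unfolding Z_def
    proof (rule Gerlits_Nagy_sum_topology)
      show "countable I" by (rule countableI_type)
      show "topspace (sum_topology (\<lambda>i. finite_power X (fst i)) I) \<noteq> {}"
        using Zne unfolding Z_def .
      show "Gerlits_Nagy_space (finite_power X (fst i))" if "i \<in> I" for i
        using that GN unfolding I_def by auto
    qed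
  next
    fix f assume "f \<in> topspace (Cp X) - {Cp_zero X}"
    then have f: "continuous_map X euclideanreal f" unfolding topspace_Cp by simp
    have "openin (finite_power X n) {x. ((n, k), x) \<in> V f}" if "(n, k) \<in> I" for n k
    proof -
      let ?e = "inverse (real (Suc k))" and ?P = "finite_power X n"
      have abs_less: "\<bar>r\<bar> < e \<longleftrightarrow> r \<in> {- e<..<e}" for r e :: real by auto
      have "{x. ((n, k), x) \<in> V f} =
          (\<Inter>j\<in>{..<n}. {x \<in> topspace ?P. f (x j) \<in> {- ?e<..<?e}}) \<inter> topspace ?P"
        using that unfolding V_def Z I_def abs_less by auto
      also have "openin ?P \<dots>"
      proof (intro openin_INT)
        fix j assume "j \<in> {..<n}"
        then have "continuous_map ?P euclideanreal (f \<circ> (\<lambda>x. x j))"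
          by (intro continuous_map_compose[OF _ f] continuous_map_finite_power_component) simp
        then have "continuous_map ?P euclideanreal (\<lambda>x. f (x j))" by (simp add: o_def)
        then show "openin ?P {x \<in> topspace ?P. f (x j) \<in> {- ?e<..<?e}}"
          by (rule openin_continuous_map_preimage) simp
      qed simp
      finally show ?thesis .
    qed
    moreover have "V f \<subseteq> topspace Z" unfolding V_def by auto
    ultimately show "openin Z (V f)" unfolding Z_def openin_sum_topology by auto
  next
    show "separated_pieces Z (topspace (Cp X) - {Cp_zero X}) V"
      unfolding separated_pieces_def
    proof (intro ballI)
      fix z f assume z: "z \<in> topspace Z" and f: "f \<in> topspace (Cp X) - {Cp_zero X}"
      obtain n k x where nkx: "z = ((n, k), x)" by (metis prod.exhaust)
      then have x: "x \<in> topspace (finite_power X n)" "n \<ge> 1" using z Z by auto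
      have "\<exists>y\<in>topspace X. f y \<noteq> 0"
      proof (rule ccontr)
        assume "\<not> ?thesis"
        moreover have "f \<in> extensional (topspace X)" using f unfolding topspace_Cp by simp
        ultimately have "f = Cp_zero X" unfolding Cp_zero_def by (intro extensionalityI[of f "topspace X"]) auto
        with f show False by simp
      qed
      then obtain y where y: "y \<in> topspace X" "\<bar>f y\<bar> > 0" by auto
      obtain k' where k': "inverse (real (Suc k')) < \<bar>f y\<bar>" using reals_Archimedean[OF y(2)] ..
      let ?k = "max k k'" and ?x = "x(n := y)"
      have "?x \<in> topspace (finite_power X (Suc n))"
        using x y(1) unfolding topspace_finite_power lessThan_Suc by (auto simp: PiE_iff extensional_def)
      then have z': "((Suc n, ?k), ?x) \<in> topspace Z" using Z by simp
      have le: "inverse (real (Suc ?k)) \<le> inverse (real (Suc k))"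
        "inverse (real (Suc ?k)) \<le> inverse (real (Suc k'))"
        by (intro le_imp_inverse_le; simp)+
      have "((Suc n, ?k), ?x) \<notin> V f"
      proof
        assume "((Suc n, ?k), ?x) \<in> V f"
        then have "\<forall>j<Suc n. \<bar>f (?x j)\<bar> < inverse (real (Suc ?k))" unfolding V_def by simp
        then have "\<bar>f (?x n)\<bar> < inverse (real (Suc ?k))" by blast
        then have "\<bar>f y\<bar> < inverse (real (Suc ?k))" by (simp only: fun_upd_same)
        with k' le(2) show False by linarith
      qed
      moreover have "z \<in> V g" if "((Suc n, ?k), ?x) \<in> V g" for g
      proof -
        have g: "\<forall>j<Suc n. \<bar>g (?x j)\<bar> < inverse (real (Suc ?k))" using that unfolding V_def by simp
        have "\<bar>g (x j)\<bar> < inverse (real (Suc k))" if "j < n" for j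
        proof -
          have "?x j = x j" using that by simp
          then have "\<bar>g (x j)\<bar> < inverse (real (Suc ?k))" using g[rule_format, of j] that by simp
          then show ?thesis using le(1) by (rule less_le_trans)
        qed
        then show ?thesis using z unfolding V_def nkx by simp
      qed
      ultimately show "\<exists>z'\<in>topspace Z. z' \<notin> V f \<and>
          (\<forall>g\<in>topspace (Cp X) - {Cp_zero X}. z' \<in> V g \<longrightarrow> z \<in> V g)"
        using z' by (intro bexI[of _ "((Suc n, ?k), ?x)"]) auto
    qed
  qed
qed

section \<open>From the function space back to omega-covers\<close>

lemma Cp_function_off_open:
  assumes X: "Hausdorff_space X" "completely_regular_space X"
    and F: "finite F" "F \<subseteq> U" and U: "openin X U"
  obtains f where "f \<in> topspace (Cp X)" "\<And>x. x \<in> F \<Longrightarrow> f x = 0"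
    "\<And>x. x \<in> topspace X - U \<Longrightarrow> f x = 1"
proof -
  have FX: "F \<subseteq> topspace X" using F(2) U openin_subset by (meson subset_trans)
  have "closedin X (topspace X - U)" using U by (simp add: closedin_diff)
  moreover have "compactin X F" using F(1) FX by (simp add: finite_imp_compactin)
  moreover have "disjnt (topspace X - U) F" using F(2) by (auto simp: disjnt_def)
  ultimately obtain g where g: "continuous_map X (top_of_set {0..1::real}) g" "g ` F \<subseteq> {0}"
      "g ` (topspace X - U) \<subseteq> {1}"
    using Urysohn_completely_regular_closed_compact[of 0 1 X "topspace X - U" F] X(2)
    by (metis zero_le_one)
  have "continuous_map X euclideanreal g" using g(1) by (simp add: continuous_map_in_subtopology)
  then have "continuous_map X euclideanreal (restrict g (topspace X))"
    by (rule continuous_map_eq) simp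
  then have "restrict g (topspace X) \<in> topspace (Cp X)" unfolding topspace_Cp by simp
  moreover have "restrict g (topspace X) x = 0" if "x \<in> F" for x using that g(2) FX by auto
  moreover have "restrict g (topspace X) x = 1" if "x \<in> topspace X - U" for x using that g(3) by auto
  ultimately show ?thesis by (rule that)
qed

text \<open>Complete regularity provides, for a finite subset of a member \<open>U\<close>, a function vanishing on it and
  equal to 1 outside \<open>U\<close>. Conversely, a function that is equal to 1 outside \<open>U\<close> and small on \<open>F\<close>
  witnesses \<open>F \<subseteq> U\<close>; this is how such functions are used below.\<close>

lemma cluster_of_omega_cover:
  assumes X: "Hausdorff_space X" "completely_regular_space X" "infinite (topspace X)"
    and \<U>: "\<U> \<in> omega_covers X"
  shows "{f \<in> topspace (Cp X). \<exists>U\<in>\<U>. \<forall>x\<in>topspace X - U. f x = 1} \<in>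
    clusters_at (Cp X) (Cp_zero X)" (is "?A \<in> _")
  unfolding clusters_at_Cp_zero_iff
proof (intro conjI allI impI)
  have opn: "openin X U" "U \<subseteq> topspace X" "U \<noteq> topspace X" if "U \<in> \<U>" for U
    using that \<U> openin_subset unfolding omega_covers_iff proper_opens_def by auto
  show "?A \<subseteq> topspace (Cp X) - {Cp_zero X}"
  proof
    fix f assume f: "f \<in> ?A"
    then obtain U where U: "U \<in> \<U>" "\<forall>x\<in>topspace X - U. f x = 1" by blast
    then obtain x where x: "x \<in> topspace X - U" using opn(2,3)[OF U(1)] by blast
    then have "f x \<noteq> Cp_zero X x" using U(2) by (simp add: Cp_zero_def)
    with f show "f \<in> topspace (Cp X) - {Cp_zero X}" by auto
  qed
  fix F and e :: real assume F: "finite F" "F \<subseteq> topspace X" "e > 0"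
  have "topspace X \<noteq> {}" using X(3) by auto
  then obtain a where "a \<in> topspace X" by blast
  then have "insert a F \<in> fin_subsets (topspace X)" using F unfolding fin_subsets_def by simp
  then obtain U where U: "U \<in> \<U>" "insert a F \<subseteq> U" using \<U> unfolding omega_covers_iff by blast
  have FU: "F \<subseteq> U" using U(2) by simp
  obtain f where f: "f \<in> topspace (Cp X)" "\<And>x. x \<in> F \<Longrightarrow> f x = 0"
      "\<And>x. x \<in> topspace X - U \<Longrightarrow> f x = 1"
    by (rule Cp_function_off_open[OF X(1,2) F(1) FU opn(1)[OF U(1)]]) (rule that)
  show "\<exists>f\<in>?A. \<forall>x\<in>F. \<bar>f x\<bar> < e"
    using f U(1) F(3) by (intro bexI[of _ f]) auto
qed

lemma S1_omega_of_S1_clusters: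
  assumes X: "Hausdorff_space X" "completely_regular_space X" "infinite (topspace X)"
    and S: "S1 (clusters_at (Cp X) (Cp_zero X)) (clusters_at (Cp X) (Cp_zero X))"
  shows "S1 (omega_covers X) (omega_covers X)"
  unfolding S1_def
proof (intro allI impI)
  fix \<U> :: "nat \<Rightarrow> 'a set set" assume \<U>: "\<forall>n. \<U> n \<in> omega_covers X"
  have "\<exists>f. (\<forall>n. f n \<in> {f \<in> topspace (Cp X). \<exists>U\<in>\<U> n. \<forall>x\<in>topspace X - U. f x = 1}) \<and>
      range f \<in> clusters_at (Cp X) (Cp_zero X)"
    by (rule S[unfolded S1_def, rule_format]) (rule cluster_of_omega_cover[OF X \<U>[rule_format]])
  then obtain f where
    f0: "(\<forall>n. f n \<in> {f \<in> topspace (Cp X). \<exists>U\<in>\<U> n. \<forall>x\<in>topspace X - U. f x = 1}) \<and>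
      range f \<in> clusters_at (Cp X) (Cp_zero X)" ..
  have "\<exists>U. U \<in> \<U> n \<and> (\<forall>x\<in>topspace X - U. f n x = 1)" for n
    using f0[THEN conjunct1, THEN spec, of n] by auto
  then have f: "\<forall>n. \<exists>U. U \<in> \<U> n \<and> (\<forall>x\<in>topspace X - U. f n x = 1)"
      "range f \<in> clusters_at (Cp X) (Cp_zero X)" using f0 by simp_all
  from choice[OF f(1)] obtain U where U: "\<forall>n. U n \<in> \<U> n \<and> (\<forall>x\<in>topspace X - U n. f n x = 1)" ..
  have "range U \<in> omega_covers X"
    unfolding omega_covers_iff
  proof (intro conjI ballI)
    have "\<U> n \<subseteq> proper_opens X" for n using \<U> unfolding omega_covers_iff by simp
    then show "range U \<subseteq> proper_opens X" using U by blast
    fix F assume "F \<in> fin_subsets (topspace X)"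
    then have F: "finite F" "F \<subseteq> topspace X" unfolding fin_subsets_def by auto
    then obtain n where n: "\<forall>x\<in>F. \<bar>f n x\<bar> < 1"
      using f(2)[unfolded clusters_at_Cp_zero_iff, THEN conjunct2, rule_format, of F 1] by auto
    have "F \<subseteq> U n"
    proof
      fix x assume x: "x \<in> F"
      show "x \<in> U n"
      proof (rule ccontr)
        assume "x \<notin> U n"
        then have "x \<in> topspace X - U n" using x F(2) by auto
        then have "f n x = 1" using U by blast
        with n x show False by auto
      qed
    qed
    then show "\<exists>V\<in>range U. F \<subseteq> V" by auto
  qed
  then show "\<exists>x. (\<forall>n. x n \<in> \<U> n) \<and> range x \<in> omega_covers X"
    using U by (intro exI[of _ U] conjI) simp_all
qed

lemma infinite_omega_cover:
  assumes ne: "topspace X \<noteq> {}" and C: "C \<in> omega_covers X"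
  shows "infinite C"
proof (rule covering_infinite[OF separated_pieces_finite_parts])
  show "topspace (Pfin X) \<noteq> {}"
  proof -
    obtain x where "x \<in> topspace X" using ne by blast
    then have "{x} \<in> topspace (Pfin X)" unfolding topspace_Pfin fin_subsets_def by simp
    then show ?thesis by blast
  qed
  show "C \<in> covering (Pfin X) (proper_opens X) (finite_parts X)"
    using C unfolding omega_covers_eq_covering .
qed

lemma omega_cover_minus_finite:
  assumes "C \<in> omega_covers X" "finite D" "D \<subseteq> C"
  shows "C - D \<in> omega_covers X"
proof -
  have "D \<subseteq> proper_opens X" using assms(1,3) unfolding omega_covers_iff by auto
  with assms(1,2) show ?thesis
    unfolding omega_covers_eq_covering by (intro covering_minus_finite separated_pieces_finite_parts)
qed

text \<open>Enumerate the cover as \<open>c\<close> and let the \<open>n\<close>-th set of functions use only members \<open>c i\<close> with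
  \<open>n \<le> i\<close>. Then only finitely many of the selected functions refer to a given \<open>c i\<close>, so a grouping of the
  functions induces blocks of members of the cover in which each member occurs finitely often.\<close>

lemma omega_groupable_of_clusters:
  assumes X: "Hausdorff_space X" "completely_regular_space X" "infinite (topspace X)"
    and S: "S1 (clusters_at (Cp X) (Cp_zero X)) (groupable (clusters_at (Cp X) (Cp_zero X)))"
    and C: "C \<in> omega_covers X" "countable C"
  shows "C \<in> groupable (omega_covers X)"
proof -
  have ne: "topspace X \<noteq> {}" using X(3) by auto
  define c where "c = from_nat_into C"
  have bij: "bij_betw c UNIV C"
    unfolding c_def by (rule bij_betw_from_nat_into[OF C(2) infinite_omega_cover[OF ne C(1)]])
  then have inj: "inj c" and ran: "range c = C" by (auto simp: bij_betw_def)
  have "C - c ` {..<n} \<in> omega_covers X" for n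
    by (rule omega_cover_minus_finite[OF C(1)]) (use ran in auto)
  then have "{f \<in> topspace (Cp X). \<exists>U\<in>C - c ` {..<n}. \<forall>x\<in>topspace X - U. f x = 1} \<in>
      clusters_at (Cp X) (Cp_zero X)" for n
    by (rule cluster_of_omega_cover[OF X])
  then have "\<exists>f. (\<forall>n. f n \<in> {f \<in> topspace (Cp X). \<exists>U\<in>C - c ` {..<n}. \<forall>x\<in>topspace X - U. f x = 1}) \<and>
      range f \<in> groupable (clusters_at (Cp X) (Cp_zero X))"
    by (intro S[unfolded S1_def, rule_format])
  then obtain f where
    f0: "(\<forall>n. f n \<in> {f \<in> topspace (Cp X). \<exists>U\<in>C - c ` {..<n}. \<forall>x\<in>topspace X - U. f x = 1}) \<and>
      range f \<in> groupable (clusters_at (Cp X) (Cp_zero X))" ..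
  have f: "\<exists>U\<in>C - c ` {..<n}. \<forall>x\<in>topspace X - U. f n x = 1" for n
    using f0[THEN conjunct1, THEN spec, of n] by (simp only: mem_Collect_eq)
  have f_groupable: "range f \<in> groupable (clusters_at (Cp X) (Cp_zero X))" using f0 ..
  have "\<exists>i. n \<le> i \<and> (\<forall>x\<in>topspace X - c i. f n x = 1)" for n
  proof -
    obtain U where U: "U \<in> C - c ` {..<n}" "\<forall>x\<in>topspace X - U. f n x = 1" using f[of n] ..
    then have "U \<in> range c" using ran by simp
    then obtain i where i: "U = c i" by (rule rangeE)
    then have "\<not> i < n" using U(1) by auto
    with U(2) i show ?thesis by (intro exI[of _ i]) simp
  qed
  then have "\<forall>n. \<exists>i. n \<le> i \<and> (\<forall>x\<in>topspace X - c i. f n x = 1)" ..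
  from choice[OF this] obtain i where i: "\<forall>n. n \<le> i n \<and> (\<forall>x\<in>topspace X - c (i n). f n x = 1)" ..
  obtain \<phi> :: "('a \<Rightarrow> real) \<Rightarrow> nat" where \<phi>: "\<And>k. finite {h \<in> range f. \<phi> h = k}"
    and ev: "\<And>Q. \<forall>D\<in>clusters_at (Cp X) (Cp_zero X). \<exists>h\<in>D. Q h \<Longrightarrow>
        \<exists>m. \<forall>k\<ge>m. \<exists>h\<in>range f. \<phi> h = k \<and> Q h"
    by (rule groupable_eventually[OF f_groupable]) (rule that)
  \<comment> \<open>The same function may be selected several times; fix one stage for it.\<close>
  define idx where "idx h = inv f h" for h
  have idx: "f (idx h) = h" if "h \<in> range f" for h
    unfolding idx_def using that by (rule f_inv_into_f)
  define G where "G k = (\<lambda>h. c (i (idx h))) ` {h \<in> range f. \<phi> h = k}" for k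
  show ?thesis
    unfolding omega_covers_eq_covering
  proof (rule groupable_coveringI[where G = G])
    show "C \<in> covering (Pfin X) (proper_opens X) (finite_parts X)"
      using C(1) unfolding omega_covers_eq_covering .
    show "countable C" by (rule C(2))
    show "finite (G k)" for k unfolding G_def using \<phi> by (rule finite_imageI)
    show "G k \<subseteq> C" for k unfolding G_def using ran by auto
    show "finite {k. U \<in> G k}" if "U \<in> C" for U
    proof -
      have "U \<in> range c" using that ran by simp
      then obtain j where j: "U = c j" by (rule rangeE)
      have "{k. U \<in> G k} \<subseteq> (\<lambda>n. \<phi> (f n)) ` {..j}"
      proof
        fix k assume "k \<in> {k. U \<in> G k}"
        then have "U \<in> (\<lambda>h. c (i (idx h))) ` {h \<in> range f. \<phi> h = k}" unfolding G_def by simp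
        then obtain h where h: "U = c (i (idx h))" "h \<in> {h \<in> range f. \<phi> h = k}" by (rule imageE)
        then have "i (idx h) = j" using inj j by (simp add: inj_eq)
        then have "idx h \<le> j" using i by metis
        moreover have "k = \<phi> (f (idx h))" using h(2) idx[of h] by simp
        ultimately show "k \<in> (\<lambda>n. \<phi> (f n)) ` {..j}" by (intro image_eqI) simp_all
      qed
      then show ?thesis by (rule finite_subset) simp
    qed
    show "\<exists>m. \<forall>k\<ge>m. \<exists>U\<in>G k. F \<in> finite_parts X U" if "F \<in> topspace (Pfin X)" for F
    proof -
      have F: "F \<in> fin_subsets (topspace X)" using that unfolding topspace_Pfin .
      then have F': "finite F" "F \<subseteq> topspace X" unfolding fin_subsets_def by auto
      have "\<forall>D\<in>clusters_at (Cp X) (Cp_zero X). \<exists>h\<in>D. \<forall>x\<in>F. \<bar>h x\<bar> < 1"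
      proof
        fix D assume "D \<in> clusters_at (Cp X) (Cp_zero X)"
        from this[unfolded clusters_at_Cp_zero_iff, THEN conjunct2, rule_format, OF F']
        show "\<exists>h\<in>D. \<forall>x\<in>F. \<bar>h x\<bar> < 1" by simp
      qed
      from ev[OF this] obtain m where m: "\<forall>k\<ge>m. \<exists>h\<in>range f. \<phi> h = k \<and> (\<forall>x\<in>F. \<bar>h x\<bar> < 1)" ..
      have "\<exists>U\<in>G k. F \<in> finite_parts X U" if k: "k \<ge> m" for k
      proof -
        have "\<exists>h\<in>range f. \<phi> h = k \<and> (\<forall>x\<in>F. \<bar>h x\<bar> < 1)" using m k by simp
        then obtain h where h: "h \<in> range f" "\<phi> h = k \<and> (\<forall>x\<in>F. \<bar>h x\<bar> < 1)" ..
        have "F \<subseteq> c (i (idx h))"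
        proof
          fix x assume x: "x \<in> F"
          show "x \<in> c (i (idx h))"
          proof (rule ccontr)
            assume "x \<notin> c (i (idx h))"
            then have "x \<in> topspace X - c (i (idx h))" using x F'(2) by auto
            then have "f (idx h) x = 1" using i[THEN spec, of "idx h"] by simp
            then show False using h(2) x idx[OF h(1)] by auto
          qed
        qed
        moreover have "c (i (idx h)) \<in> G k" unfolding G_def using h by simp
        ultimately show ?thesis using F unfolding finite_parts_def by (intro bexI[of _ "c (i (idx h))"]) simp_all
      qed
      then show ?thesis by (intro exI[of _ m] allI impI)
    qed
  qed
qed

section \<open>Translations of the function space\<close>

definition translate :: "'a topology \<Rightarrow> ('a \<Rightarrow> real) \<Rightarrow> ('a \<Rightarrow> real) \<Rightarrow> 'a \<Rightarrow> real" where
  "translate X h f = (\<lambda>x\<in>topspace X. f x + h x)"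

lemma continuous_map_translate:
  assumes h: "continuous_map X euclideanreal h"
  shows "continuous_map (Cp X) (Cp X) (translate X h)"
proof -
  have top: "translate X h f \<in> topspace (Cp X)" if "f \<in> topspace (Cp X)" for f
  proof -
    have "continuous_map X euclideanreal (\<lambda>x. f x + h x)"
      using that h unfolding topspace_Cp by (intro continuous_map_add) auto
    then have "continuous_map X euclideanreal (translate X h f)"
      by (rule continuous_map_eq) (simp add: translate_def)
    then show ?thesis unfolding topspace_Cp by (simp add: translate_def)
  qed
  have "continuous_map (Cp X) (product_topology (\<lambda>_. euclideanreal) (topspace X)) (translate X h)"
    unfolding continuous_map_componentwise
  proof (intro conjI ballI)
    show "translate X h ` topspace (Cp X) \<subseteq> extensional (topspace X)"
      by (auto simp: translate_def)
    fix x assume x: "x \<in> topspace X"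
    have "continuous_map (Cp X) euclideanreal (\<lambda>f. f x + h x)"
      by (intro continuous_map_add continuous_map_Cp_evaluation x continuous_map_const[THEN iffD2]) simp
    then show "continuous_map (Cp X) euclideanreal (\<lambda>f. translate X h f x)"
      using x by (simp add: translate_def)
  qed
  then have "continuous_map (Cp X) (subtopology (product_topology (\<lambda>_. euclideanreal) (topspace X))
      {f. continuous_map X euclideanreal f}) (translate X h)"
    unfolding continuous_map_in_subtopology using top unfolding topspace_Cp by auto
  then show ?thesis unfolding Cp_def[of X, symmetric] .
qed

lemma homeomorphic_map_translate:
  assumes h: "continuous_map X euclideanreal h"
  shows "homeomorphic_map (Cp X) (Cp X) (translate X h)"
proof -
  have h': "continuous_map X euclideanreal (\<lambda>x. - h x)" using h by (rule continuous_map_minus)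
  have inv: "translate X g (translate X k f) = f"
    if "f \<in> topspace (Cp X)" "\<And>x. g x + k x = 0" for f g k
  proof (rule extensionalityI[of _ "topspace X"])
    show "f \<in> extensional (topspace X)" using that unfolding topspace_Cp by simp
    show "translate X g (translate X k f) x = f x" if "x \<in> topspace X" for x
      using \<open>\<And>x. g x + k x = 0\<close>[of x] that unfolding translate_def by simp
  qed (simp add: translate_def)
  have "homeomorphic_maps (Cp X) (Cp X) (translate X h) (translate X (\<lambda>x. - h x))"
    unfolding homeomorphic_maps_def
    using continuous_map_translate[OF h] continuous_map_translate[OF h'] inv by simp
  then show ?thesis by (rule homeomorphic_maps_imp_map)
qed

lemma clusters_at_homeomorphic_image:
  assumes b: "homeomorphic_map Z Y b" and z: "z \<in> topspace Z" and A: "A \<subseteq> topspace Z"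
  shows "b ` A \<in> clusters_at Y (b z) \<longleftrightarrow> A \<in> clusters_at Z z"
proof -
  have inj: "inj_on b (topspace Z)" by (rule homeomorphic_imp_injective_map[OF b])
  have im: "b ` topspace Z = topspace Y" by (rule homeomorphic_imp_surjective_map[OF b])
  have cl: "Y closure_of (b ` A) = b ` (Z closure_of A)"
    using homeomorphic_map_closure_of[OF b A] by simp
  have mem: "b z \<in> b ` S \<longleftrightarrow> z \<in> S" if "S \<subseteq> topspace Z" for S
    using inj_on_image_mem_iff[OF inj z that] .
  have "b z \<in> Y closure_of (b ` A) \<longleftrightarrow> z \<in> Z closure_of A"
    unfolding cl by (rule mem[OF closure_of_subset_topspace])
  moreover have "b ` A \<subseteq> topspace Y" using A unfolding im[symmetric] by (rule image_mono)
  ultimately show ?thesis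
    unfolding clusters_at_def using A mem[OF A] by (simp only: mem_Collect_eq Diff_iff simp_thms)
qed

lemma groupable_imp_countable:
  assumes "C \<in> groupable \<CC>"
  shows "countable C"
proof -
  obtain \<phi> :: "'a \<Rightarrow> nat" where \<phi>: "\<And>n. finite {c \<in> C. \<phi> c = n}"
    by (rule groupable_eventually[OF assms]) (rule that)
  have "countable (\<Union>n. {c \<in> C. \<phi> c = n})" by (intro countable_UN countableI_type countable_finite[OF \<phi>])
  moreover have "C \<subseteq> (\<Union>n. {c \<in> C. \<phi> c = n})" by auto
  ultimately show ?thesis by (rule countable_subset[rotated])
qed

lemma infinite_cluster:
  assumes Z: "Hausdorff_space Z" and A: "A \<in> clusters_at Z z"
  shows "infinite A"
proof
  assume "finite A"
  have "A \<subseteq> topspace Z" "z \<in> Z closure_of A" "z \<notin> A" using A unfolding clusters_at_def by auto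
  moreover have "closedin Z A" by (rule closedin_Hausdorff_finite[OF Z]) fact+
  ultimately show False by (simp add: closure_of_closedin)
qed

lemma Hausdorff_space_Cp: "Hausdorff_space (Cp X)"
  unfolding Cp_def by (intro Hausdorff_space_subtopology) (simp add: Hausdorff_space_product_topology)

lemma S1_clusters_groupable_iff_Reznichenko:
  "S1 (clusters_at (Cp X) (Cp_zero X)) (groupable (clusters_at (Cp X) (Cp_zero X))) \<longleftrightarrow>
    Reznichenko_space (Cp X) \<and> countable_strong_fan_tightness (Cp X)"
proof
  let ?K = "clusters_at (Cp X)"
  assume S0: "S1 (?K (Cp_zero X)) (groupable (?K (Cp_zero X)))"
  have S: "S1 (?K g) (groupable (?K g))" if g: "g \<in> topspace (Cp X)" for g
  proof -
    let ?b = "translate X (\<lambda>x. - g x)"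
    have "continuous_map X euclideanreal g" using g unfolding topspace_Cp by simp
    then have b: "homeomorphic_map (Cp X) (Cp X) ?b"
      by (intro homeomorphic_map_translate continuous_map_minus)
    have "?b g = Cp_zero X" unfolding translate_def Cp_zero_def by simp
    then have tr: "?b ` A \<in> ?K (Cp_zero X) \<longleftrightarrow> A \<in> ?K g" if "A \<subseteq> topspace (Cp X)" for A
      using clusters_at_homeomorphic_image[OF b g that] by simp
    show ?thesis
    proof (rule S1_transfer[OF S0])
      show "A \<subseteq> topspace (Cp X) \<and> ?b ` A \<in> ?K (Cp_zero X)" if "A \<in> ?K g" for A
        using that tr[of A] unfolding clusters_at_def[of _ g] by simp
      show "A \<in> groupable (?K g)"
        if "A \<subseteq> topspace (Cp X)" "?b ` A \<in> groupable (?K (Cp_zero X))" for A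
        by (rule groupable_transfer[OF homeomorphic_imp_injective_map[OF b] that]) (simp add: tr)
    qed
  qed
  have "?K g \<inter> ctbl_inf_subsets (topspace (Cp X)) = groupable (?K g)" if g: "g \<in> topspace (Cp X)" for g
  proof (intro equalityI subsetI)
    fix A assume "A \<in> ?K g \<inter> ctbl_inf_subsets (topspace (Cp X))"
    then have A: "A \<in> ?K g" "countable A" unfolding ctbl_inf_subsets_def by auto
    have between: "D \<in> ?K g" if "C \<in> ?K g" "E \<in> ?K g" "C \<subseteq> D" "D \<subseteq> E" for C D E
      using that closure_of_mono[OF that(3), of "Cp X"] unfolding clusters_at_def by auto
    show "A \<in> groupable (?K g)"
      by (rule S1_groupable_imp_countable_groupable[OF S[OF g] _ A]) (rule between)
  next
    fix A assume A: "A \<in> groupable (?K g)"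
    then have AK: "A \<in> ?K g" unfolding groupable_def by simp
    have "A \<subseteq> topspace (Cp X)" using AK unfolding clusters_at_def by simp
    moreover have "countable A" by (rule groupable_imp_countable[OF A])
    moreover have "infinite A" by (rule infinite_cluster[OF Hausdorff_space_Cp AK])
    ultimately show "A \<in> ?K g \<inter> ctbl_inf_subsets (topspace (Cp X))"
      using AK unfolding ctbl_inf_subsets_def by simp
  qed
  then have "Reznichenko_space (Cp X)" unfolding Reznichenko_space_def by simp
  moreover have "countable_strong_fan_tightness (Cp X)"
    unfolding countable_strong_fan_tightness_def using S1_groupable_imp_S1[OF S] by simp
  ultimately show "Reznichenko_space (Cp X) \<and> countable_strong_fan_tightness (Cp X)" ..
next
  let ?K = "clusters_at (Cp X) (Cp_zero X)"
  assume R: "Reznichenko_space (Cp X) \<and> countable_strong_fan_tightness (Cp X)"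
  then have "S1 ?K ?K" unfolding countable_strong_fan_tightness_def using Cp_zero_in_Cp by blast
  then show "S1 ?K (groupable ?K)"
  proof (rule S1_groupableI)
    fix A assume A: "A \<in> ?K" "countable A"
    have "A \<subseteq> topspace (Cp X)" using A(1) unfolding clusters_at_def by simp
    then have "A \<in> ctbl_inf_subsets (topspace (Cp X))"
      using A(2) infinite_cluster[OF Hausdorff_space_Cp A(1)] unfolding ctbl_inf_subsets_def by simp
    moreover have "?K \<inter> ctbl_inf_subsets (topspace (Cp X)) = groupable ?K"
      using R Cp_zero_in_Cp unfolding Reznichenko_space_def by blast
    ultimately show "A \<in> groupable ?K" using A(1) by blast
  qed
qed

section \<open>The equivalences\<close>

theorem theorem46:
  fixes X :: "'a topology"
  assumes "Hausdorff_space X" and "completely_regular_space X"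
    and "infinite (topspace X)"
  shows "(Gerlits_Nagy_space (Pfin X)
          \<longleftrightarrow> S1 (omega_covers (Pfin X)) (groupable (omega_covers (Pfin X))))
    \<and> (S1 (omega_covers (Pfin X)) (groupable (omega_covers (Pfin X)))
          \<longleftrightarrow> S1 (omega_covers X) (groupable (omega_covers X)))
    \<and> (S1 (omega_covers X) (groupable (omega_covers X))
          \<longleftrightarrow> (\<forall>n\<ge>1. Gerlits_Nagy_space (finite_power X n)))
    \<and> ((\<forall>n\<ge>1. Gerlits_Nagy_space (finite_power X n))
          \<longleftrightarrow> (\<nexists>\<sigma>. winning_strategy_One (omega_covers X) (groupable (omega_covers X)) \<sigma>))
    \<and> ((\<nexists>\<sigma>. winning_strategy_One (omega_covers X) (groupable (omega_covers X)) \<sigma>)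
          \<longleftrightarrow> S1 (clusters_at (Cp X) (Cp_zero X)) (groupable (clusters_at (Cp X) (Cp_zero X))))
    \<and> (S1 (clusters_at (Cp X) (Cp_zero X)) (groupable (clusters_at (Cp X) (Cp_zero X)))
          \<longleftrightarrow> Reznichenko_space (Cp X) \<and> countable_strong_fan_tightness (Cp X))"
    (is "(?GN \<longleftrightarrow> ?PS) \<and> (_ \<longleftrightarrow> ?S) \<and> (_ \<longleftrightarrow> ?powers) \<and> (_ \<longleftrightarrow> ?game) \<and> (_ \<longleftrightarrow> ?C) \<and> (_ \<longleftrightarrow> ?R)")
proof -
  have ne: "topspace X \<noteq> {}" using assms(3) by auto
  have GN_game: "?GN \<Longrightarrow> ?game" using no_winning_strategy_omega_covers[OF _ ne] by blast
  have game_S: "?game \<Longrightarrow> ?S" by (rule no_winning_strategy_imp_S1)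
  have S_powers: "?S \<Longrightarrow> ?powers"
    unfolding Gerlits_Nagy_space_def
    using Hurewicz_finite_power[OF assms(1,3)] Rothberger_finite_power[OF assms(1,3)]
      S1_groupable_imp_S1[of "omega_covers X"] by simp
  have powers_GN: "?powers \<Longrightarrow> ?GN" using Gerlits_Nagy_Pfin[OF _ ne] by simp
  have powers_PS: "?powers \<Longrightarrow> ?PS" using S1_omega_groupable_Pfin[OF _ ne] by simp
  have powers_C: "?powers \<Longrightarrow> ?C" using S1_clusters_groupable_Cp_zero[OF _ ne] by simp
  have PS_S: "?PS \<Longrightarrow> ?S" by (rule S1_omega_groupable_of_Pfin)
  have C_S: "?S" if ?C
    using S1_omega_of_S1_clusters[OF assms S1_groupable_imp_S1[OF that]]
    by (rule S1_groupableI) (rule omega_groupable_of_clusters[OF assms that])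
  have C_R: "?C \<longleftrightarrow> ?R" by (rule S1_clusters_groupable_iff_Reznichenko)
  show ?thesis
    using GN_game game_S S_powers powers_GN powers_PS powers_C PS_S C_S C_R by argo
qed

end
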